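(* For all positive integers $n,m$ and every integer $1\le k<m$, the exact quantum query complexity of $h_{k,n,m}$ satisfies $Q_E(h_{k,n,m})=O\!\left(n\sqrt{m/k}+kn+m\right)$.
   Context: Let $n,m$ be positive integers, $1\le k<m$ an integer, $M=[n]\times[m]$ (a grid of cells with $n$ rows and $m$ columns), $\tilde M=M\cup\{\bot\}$ (pointers to cells, $\bot$ the null pointer). Let $T$ be the following fixed binary tree with $m$ leaves and $m-1$ internal nodes: if $m=2^r$, $T$ is the complete binary tree with $2^r$ leaves; if $2^r<m<2^{r+1}$, take the complete binary tree with $2^r$ leaves and add a pair of children to each of its $m-2^r$ leftmost leaves. Outgoing arcs are labeled 'left'/'right', leaves labeled $1,\dots,m$ from left to right, and $T(j)$ is the sequence of labels on the root-to-leaf-$j$ path. The alphabet is $\Sigma=\{0,1\}\times\tilde M\times\tilde M\times\tilde M$ with components $\mathrm{val},\mathrm{lpoint},\mathrm{rpoint},\mathrm{ipoint}$. The function $h_{k,n,m}\colon\Sigma^M\to\{0,1\}$ has $h_{k,n,m}(x)=1$ iff: (1) there are exactly $k$ columns $b_1,\dots,b_k$ with $\mathrm{val}(x_{i,b_s})=1$ for all $i\in[n]$, $s\in[k]$ (marked columns); (2) each marked column $b_s$ contains a unique cell $a_s$ with $x_{a_s}\ne(1,\bot,\bot,\bot)$ (special elements); (3) $\mathrm{ipoint}(x_{a_s})=a_{s+1}$ for $s\in[k-1]$, $\mathrm{ipoint}(x_{a_k})=a_1$, and $\mathrm{lpoint}(x_{a_s})=\mathrm{lpoint}(x_{a_t})$,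 $\mathrm{rpoint}(x_{a_s})=\mathrm{rpoint}(x_{a_t})$ for all $s,t\in[k]$; (4) for each non-marked column $j$, the path starting at a special element and following $\mathrm{lpoint},\mathrm{rpoint}$ as specified by $T(j)$ exists (no $\bot$ on it) and ends at a cell $\ell_j$ in column $j$ with $\mathrm{val}(x_{\ell_j})=0$. $Q_E(f)$ is the minimum number of queries of a quantum query algorithm (queries $O_x|c,p\rangle|w\rangle=|c,p+x_c\bmod|\Sigma|\rangle|w\rangle$, $\Sigma$ identified with $[|\Sigma|]$) outputting $f(x)$ with probability $1$ on every input. *)

theory Defs
  imports Complex_Main
begin

(* A cell (i,j) with 1 <= i <= n (row) and 1 <= j <= m (column). *)
type_synonym cell = "nat \<times> nat"

(* Sigma = {0,1} x Mtilde x Mtilde x Mtilde: (val, lpoint, rpoint, ipoint);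
   val = 1 is encoded as True; the null pointer \<bottom> is None. *)
type_synonym sym = "bool \<times> cell option \<times> cell option \<times> cell option"

definition cells :: "nat \<Rightarrow> nat \<Rightarrow> cell set" where
  "cells n m = {1..n} \<times> {1..m}"

definition val :: "sym \<Rightarrow> bool" where "val s = fst s"
definition lpoint :: "sym \<Rightarrow> cell option" where "lpoint s = fst (snd s)"
definition rpoint :: "sym \<Rightarrow> cell option" where "rpoint s = fst (snd (snd s))"
definition ipoint :: "sym \<Rightarrow> cell option" where "ipoint s = snd (snd (snd s))"

definition valid_ptr :: "nat \<Rightarrow> nat \<Rightarrow> cell option \<Rightarrow> bool" where
  "valid_ptr n m p = (case p of None \<Rightarrow> True | Some c \<Rightarrow> c \<in> cells n m)"

(* x \<in> Sigma^M : on every cell of M, all pointers lie in Mtilde.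
   (Values of x outside M are irrelevant and never inspected.) *)
definition valid_input :: "nat \<Rightarrow> nat \<Rightarrow> (cell \<Rightarrow> sym) \<Rightarrow> bool" where
  "valid_input n m x = (\<forall>c\<in>cells n m. valid_ptr n m (lpoint (x c)) \<and>
      valid_ptr n m (rpoint (x c)) \<and> valid_ptr n m (ipoint (x c)))"

datatype btree = Leaf | Node btree btree

fun complete_tree :: "nat \<Rightarrow> btree" where
  "complete_tree 0 = Leaf"
| "complete_tree (Suc r) = Node (complete_tree r) (complete_tree r)"

fun grow :: "nat \<Rightarrow> btree \<Rightarrow> btree \<times> nat" where
  "grow d Leaf = (if d > 0 then (Node Leaf Leaf, d - 1) else (Leaf, 0))"
| "grow d (Node l r) = (let (l', d') = grow d l; (r', d'') = grow d' r in (Node l' r', d''))"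

definition tree_depth_exp :: "nat \<Rightarrow> nat" where
  "tree_depth_exp m = (THE r. 2 ^ r \<le> m \<and> m < 2 ^ Suc r)"

definition the_tree :: "nat \<Rightarrow> btree" where
  "the_tree m = fst (grow (m - 2 ^ tree_depth_exp m) (complete_tree (tree_depth_exp m)))"

fun leaf_paths :: "btree \<Rightarrow> bool list list" where
  "leaf_paths Leaf = [[]]"
| "leaf_paths (Node l r) = map (Cons False) (leaf_paths l) @ map (Cons True) (leaf_paths r)"

definition tree_path :: "nat \<Rightarrow> nat \<Rightarrow> bool list" where
  "tree_path m j = leaf_paths (the_tree m) ! (j - 1)"

fun follow :: "(cell \<Rightarrow> sym) \<Rightarrow> cell \<Rightarrow> bool list \<Rightarrow> cell option" where
  "follow x c [] = Some c"
| "follow x c (d # ds) =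
     (case (if d then rpoint (x c) else lpoint (x c)) of
        None \<Rightarrow> None
      | Some c' \<Rightarrow> follow x c' ds)"

definition marked_cols :: "nat \<Rightarrow> nat \<Rightarrow> (cell \<Rightarrow> sym) \<Rightarrow> nat set" where
  "marked_cols n m x = {j \<in> {1..m}. \<forall>i\<in>{1..n}. val (x (i, j))}"

definition is_special :: "nat \<Rightarrow> nat \<Rightarrow> (cell \<Rightarrow> sym) \<Rightarrow> cell \<Rightarrow> bool" where
  "is_special n m x a = (a \<in> cells n m \<and> snd a \<in> marked_cols n m x \<and>
      x a \<noteq> (True, None, None, None))"

definition h_fun :: "nat \<Rightarrow> nat \<Rightarrow> nat \<Rightarrow> (cell \<Rightarrow> sym) \<Rightarrow> bool" where
  "h_fun k n m x = (
     card (marked_cols n m x) = k \<and>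
     (\<forall>b\<in>marked_cols n m x. \<exists>!i. i \<in> {1..n} \<and> x (i, b) \<noteq> (True, None, None, None)) \<and>
     (\<exists>a. (\<forall>s\<in>{1..k}. is_special n m x (a s)) \<and>
          bij_betw (\<lambda>s. snd (a s)) {1..k} (marked_cols n m x) \<and>
          (\<forall>s\<in>{1..<k}. ipoint (x (a s)) = Some (a (Suc s))) \<and>
          ipoint (x (a k)) = Some (a 1) \<and>
          (\<forall>s\<in>{1..k}. \<forall>t\<in>{1..k}. lpoint (x (a s)) = lpoint (x (a t)) \<and>
                                  rpoint (x (a s)) = rpoint (x (a t)))) \<and>
     (\<forall>j\<in>{1..m} - marked_cols n m x. \<forall>a. is_special n m x a \<longrightarrow>
        (\<exists>l. follow x a (tree_path m j) = Some l \<and> snd l = j \<and> \<not> val (x l))))"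

(* identification of Sigma with [|Sigma|] = {0..<2*(n*m+1)^3} *)
definition ptr_code :: "nat \<Rightarrow> cell option \<Rightarrow> nat" where
  "ptr_code m p = (case p of None \<Rightarrow> 0 | Some (i, j) \<Rightarrow> 1 + (i - 1) * m + (j - 1))"

definition alph_size :: "nat \<Rightarrow> nat \<Rightarrow> nat" where
  "alph_size n m = 2 * (n * m + 1) ^ 3"

definition sym_code :: "nat \<Rightarrow> nat \<Rightarrow> sym \<Rightarrow> nat" where
  "sym_code n m s = (if val s then 1 else 0) + 2 * (ptr_code m (lpoint s) +
      (n * m + 1) * (ptr_code m (rpoint s) + (n * m + 1) * ptr_code m (ipoint s)))"

(* query register index c \<in> {0..<n*m} addresses the cell (c div m + 1, c mod m + 1) *)
definition cell_of :: "nat \<Rightarrow> nat \<Rightarrow> cell" where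
  "cell_of m c = (c div m + 1, c mod m + 1)"

(* computational basis: |c, p> |w>, c \<in> [nm], p \<in> [|Sigma|], w \<in> [W] *)
type_synonym idx = "nat \<times> nat \<times> nat"
type_synonym state = "idx \<Rightarrow> complex"
type_synonym op = "idx \<Rightarrow> idx \<Rightarrow> complex"

definition basis :: "nat \<Rightarrow> nat \<Rightarrow> nat \<Rightarrow> idx set" where
  "basis n m W = {0..<n * m} \<times> {0..<alph_size n m} \<times> {0..<W}"

definition unitary_on :: "idx set \<Rightarrow> op \<Rightarrow> bool" where
  "unitary_on B U = (\<forall>a\<in>B. \<forall>b\<in>B.
      (\<Sum>c\<in>B. U a c * cnj (U b c)) = (if a = b then 1 else 0))"

definition apply_op :: "idx set \<Rightarrow> op \<Rightarrow> state \<Rightarrow> state" where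
  "apply_op B U \<psi> = (\<lambda>a. \<Sum>b\<in>B. U a b * \<psi> b)"

(* O_x |c,p>|w> = |c, p + x_c mod |Sigma|>|w> *)
definition query_op :: "nat \<Rightarrow> nat \<Rightarrow> (cell \<Rightarrow> sym) \<Rightarrow> state \<Rightarrow> state" where
  "query_op n m x \<psi> = (\<lambda>(c, p, w). \<psi> (c,
      (p + alph_size n m - sym_code n m (x (cell_of m c)) mod alph_size n m) mod alph_size n m, w))"

definition init_state :: state where
  "init_state = (\<lambda>a. if a = (0, 0, 0) then 1 else 0)"

definition final_state :: "nat \<Rightarrow> nat \<Rightarrow> nat \<Rightarrow> op list \<Rightarrow> (cell \<Rightarrow> sym) \<Rightarrow> state" where
  "final_state n m W Us x =
     foldl (\<lambda>\<psi> U. apply_op (basis n m W) U (query_op n m x \<psi>))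
           (apply_op (basis n m W) (hd Us) init_state) (tl Us)"

(* an exact algorithm with T queries: measuring the final state in the
   computational basis and post-processing with out gives f x with probability 1 *)
definition exact_alg :: "nat \<Rightarrow> nat \<Rightarrow> ((cell \<Rightarrow> sym) \<Rightarrow> bool) \<Rightarrow> nat \<Rightarrow> bool" where
  "exact_alg n m f T = (\<exists>W > 0. \<exists>Us out.
      length Us = Suc T \<and> (\<forall>U\<in>set Us. unitary_on (basis n m W) U) \<and>
      (\<forall>x. valid_input n m x \<longrightarrow>
         (\<forall>b\<in>basis n m W. out b \<noteq> f x \<longrightarrow> final_state n m W Us x b = 0)))"

definition QE :: "nat \<Rightarrow> nat \<Rightarrow> ((cell \<Rightarrow> sym) \<Rightarrow> bool) \<Rightarrow> nat" where
  "QE n m f = (LEAST T. exact_alg n m f T)"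

end

theory Submission
  imports Defs "HOL-Library.Nat_Bijection"
begin

text \<open>
  Grover search over the columns, where testing a column costs \<open>n\<close> queries and \<open>n\<close> more to
  uncompute, is made exact for exactly \<open>k\<close> marked columns by adding a dummy column to the search
  space, whose weight lowers the rotation angle to \<open>\<theta> = \<pi> / (2 (2 r + 1))\<close> with
  \<open>r = \<lceil>sqrt (m / k)\<rceil>\<close>. On a positive input the search hence ends on a marked column with
  certainty. From it the pointers lead to the other marked columns and to the at most \<open>2 m\<close> cells
  on the tree paths, and these \<open>k n + 2 m\<close> cells certify the value. The algorithm accepts iff the
  answers it has seen force the value 1, so negative inputs, for which the search result is
  arbitrary, are never accepted.
\<close>

section \<open>Unitaries and superpositions\<close>

text \<open>The certificate is too expensive to collect in every Grover round, so it is collected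
  once after the search and the two costs add. One adaptive strategy serves both purposes: stopped
  at time \<open>n\<close> it is the column test, run further it collects the certificate. Between
  steps the state is a superposition, indexed by the start column, of classical configurations, so
  after the start state is prepared the only gates are permutations, sign changes and one
  reflection. The reflection acts on start configurations, and answers left over from a test would
  block interference between columns; this forces the uncomputation. A dummy can only dilute the
  marked weight, so its use requires \<open>(sin \<theta>)\<^sup>2 \<le> k / m\<close>; this is why
  \<open>r\<close> is of order sqrt (m / k). A single marked column is enough to start from, since
  the special elements form one cycle and share their left and right pointers.\<close>

lemma finite_basis [simp]: "finite (basis n m W)"
  by (simp add: basis_def)

text \<open>Gates are specified only on configurations that occur. As \<open>A\<close> and its image
  are equally large, so are their complements in \<open>B\<close>, and any bijection between these
  fills the gap.\<close>

lemma extend_to_permutation: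
  assumes "finite B" "A \<subseteq> B" "inj_on f A" "f ` A \<subseteq> B"
  obtains g where "bij_betw g B B" "\<And>a. a \<in> A \<Longrightarrow> g a = f a"
proof -
  have fA: "finite A" using assms finite_subset by blast
  have "card (B - A) = card (B - f ` A)"
    using assms fA by (simp add: card_Diff_subset card_image)
  then obtain h where h: "bij_betw h (B - A) (B - f ` A)"
    using finite_same_card_bij assms(1) by blast
  let ?g = "\<lambda>a. if a \<in> A then f a else h a"
  have "bij_betw ?g A (f ` A)"
    using assms(3) by (subst bij_betw_cong[of A ?g f]) (auto simp: inj_on_imp_bij_betw)
  moreover have "bij_betw ?g (B - A) (B - f ` A)"
    using h by (subst bij_betw_cong[of "B - A" ?g h]) auto
  ultimately have "bij_betw ?g (A \<union> (B - A)) (f ` A \<union> (B - f ` A))"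
    by (rule bij_betw_combine) auto
  then have "bij_betw ?g B B"
    using assms(2,4) by (simp add: Un_absorb1)
  then show thesis by (rule that) simp
qed

definition perm_op :: "(idx \<Rightarrow> idx) \<Rightarrow> op" where
  "perm_op g = (\<lambda>a b. if a = g b then 1 else 0)"

definition diag_op :: "(idx \<Rightarrow> real) \<Rightarrow> op" where
  "diag_op s = (\<lambda>a b. if a = b then complex_of_real (s b) else 0)"

definition refl_op :: "(idx \<Rightarrow> real) \<Rightarrow> op" where
  "refl_op u = (\<lambda>a b. complex_of_real ((if a = b then 1 else 0) - 2 * u a * u b))"

lemma unitary_perm_op:
  assumes "finite B" "bij_betw g B B"
  shows "unitary_on B (perm_op g)"
  unfolding unitary_on_def
proof (intro ballI)
  fix a b assume a: "a \<in> B" and b: "b \<in> B"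
  obtain a' where a': "a' \<in> B" "g a' = a"
    using assms(2) a by (metis bij_betw_iff_bijections)
  have inj: "g c = a \<longleftrightarrow> c = a'" if "c \<in> B" for c
    using assms(2) a' that by (metis bij_betw_iff_bijections)
  have "(\<Sum>c\<in>B. perm_op g a c * cnj (perm_op g b c)) = (\<Sum>c\<in>B. if c = a' then (if a = b then 1 else 0) else 0)"
  proof (rule sum.cong[OF refl])
    fix c assume "c \<in> B"
    then show "perm_op g a c * cnj (perm_op g b c) = (if c = a' then (if a = b then 1 else 0) else 0)"
      using inj[of c] a'(2) by (auto simp: perm_op_def simp del: split_paired_All)
  qed
  also have "\<dots> = (if a = b then 1 else 0)"
    using assms(1) a' by simp
  finally show "(\<Sum>c\<in>B. perm_op g a c * cnj (perm_op g b c)) = (if a = b then 1 else 0)" .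
qed

lemma unitary_diag_op:
  assumes "finite B" "\<And>a. s a * s a = 1"
  shows "unitary_on B (diag_op s)"
  unfolding unitary_on_def
proof (intro ballI)
  fix a b assume a: "a \<in> B" and b: "b \<in> B"
  have "(\<Sum>c\<in>B. diag_op s a c * cnj (diag_op s b c)) = (\<Sum>c\<in>B. if c = a then (if a = b then 1 else 0) else 0)"
    by (rule sum.cong) (auto simp: diag_op_def assms(2) simp flip: of_real_mult)
  then show "(\<Sum>c\<in>B. diag_op s a c * cnj (diag_op s b c)) = (if a = b then 1 else 0)"
    using assms(1) a by simp
qed

lemma unitary_refl_op:
  assumes "finite B" "(\<Sum>c\<in>B. u c * u c) = 1"
  shows "unitary_on B (refl_op u)"
  unfolding unitary_on_def
proof (intro ballI)
  fix a b assume a: "a \<in> B" and b: "b \<in> B"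
  let ?d = "\<lambda>x y. if x = (y::idx) then 1 else (0::real)"
  have "(\<Sum>c\<in>B. (?d a c - 2 * u a * u c) * (?d b c - 2 * u b * u c))
      = (\<Sum>c\<in>B. (if c = a then ?d a b else 0) - (if c = a then 2 * u b * u a else 0)
            - (if c = b then 2 * u a * u b else 0) + 4 * u a * u b * (u c * u c))"
    by (rule sum.cong) (auto simp: algebra_simps)
  also have "\<dots> = ?d a b - 2 * u b * u a - 2 * u a * u b + 4 * u a * u b * (\<Sum>c\<in>B. u c * u c)"
    using assms(1) a b by (simp add: sum.distrib sum_subtractf sum_distrib_left)
  also have "\<dots> = ?d a b" using assms(2) by simp
  finally have "complex_of_real (\<Sum>c\<in>B. (?d a c - 2 * u a * u c) * (?d b c - 2 * u b * u c))
      = complex_of_real (?d a b)" by simp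
  then show "(\<Sum>c\<in>B. refl_op u a c * cnj (refl_op u b c)) = (if a = b then 1 else 0)"
    by (simp add: refl_op_def of_real_sum split: if_splits)
qed

definition comp_op :: "idx set \<Rightarrow> op \<Rightarrow> op \<Rightarrow> op" where
  "comp_op B U V = (\<lambda>a b. \<Sum>c\<in>B. U a c * V c b)"

lemma apply_comp_op: "apply_op B (comp_op B U V) \<psi> = apply_op B U (apply_op B V \<psi>)"
proof
  fix a
  have "apply_op B (comp_op B U V) \<psi> a = (\<Sum>b\<in>B. \<Sum>c\<in>B. U a c * V c b * \<psi> b)"
    by (simp add: apply_op_def comp_op_def sum_distrib_right)
  also have "\<dots> = (\<Sum>c\<in>B. \<Sum>b\<in>B. U a c * V c b * \<psi> b)" by (rule sum.swap)
  also have "\<dots> = apply_op B U (apply_op B V \<psi>) a"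
    by (simp add: apply_op_def sum_distrib_left mult.assoc)
  finally show "apply_op B (comp_op B U V) \<psi> a = apply_op B U (apply_op B V \<psi>) a" .
qed

lemma unitary_comp_op:
  assumes "finite B" and U: "unitary_on B U" and V: "unitary_on B V"
  shows "unitary_on B (comp_op B U V)"
  unfolding unitary_on_def
proof (intro ballI)
  fix a b assume a: "a \<in> B" and b: "b \<in> B"
  have "(\<Sum>c\<in>B. comp_op B U V a c * cnj (comp_op B U V b c))
      = (\<Sum>c\<in>B. \<Sum>d\<in>B. \<Sum>e\<in>B. (U a d * cnj (U b e)) * (V d c * cnj (V e c)))"
    by (simp add: comp_op_def sum_product algebra_simps)
  also have "\<dots> = (\<Sum>d\<in>B. \<Sum>c\<in>B. \<Sum>e\<in>B. (U a d * cnj (U b e)) * (V d c * cnj (V e c)))"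
    by (rule sum.swap)
  also have "\<dots> = (\<Sum>d\<in>B. \<Sum>e\<in>B. \<Sum>c\<in>B. (U a d * cnj (U b e)) * (V d c * cnj (V e c)))"
    by (intro sum.cong refl sum.swap)
  also have "\<dots> = (\<Sum>d\<in>B. \<Sum>e\<in>B. (U a d * cnj (U b e)) * (if d = e then 1 else 0))"
    using V by (intro sum.cong refl) (simp add: unitary_on_def flip: sum_distrib_left)
  also have "\<dots> = (\<Sum>d\<in>B. U a d * cnj (U b d))"
    using assms(1) by (intro sum.cong refl) (simp add: if_distrib cong: if_cong)
  also have "\<dots> = (if a = b then 1 else 0)"
    using U a b by (simp add: unitary_on_def)
  finally show "(\<Sum>c\<in>B. comp_op B U V a c * cnj (comp_op B U V b c)) = (if a = b then 1 else 0)" .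
qed

lemma perm_op_id: "apply_op B (perm_op id) \<psi> b = \<psi> b" if "finite B" "b \<in> B"
  using that by (simp add: apply_op_def perm_op_def if_distrib[of "\<lambda>t. t * _"] cong: if_cong)

text \<open>A sum over labels rather than a function on basis states: linear gates then act on
  \<alpha> or \<kappa> label by label, even where values of \<kappa> coincide.\<close>

definition superpos :: "nat set \<Rightarrow> (nat \<Rightarrow> real) \<Rightarrow> (nat \<Rightarrow> idx) \<Rightarrow> state" where
  "superpos J \<alpha> \<kappa> = (\<lambda>a. \<Sum>j\<in>J. if a = \<kappa> j then complex_of_real (\<alpha> j) else 0)"

lemma apply_superpos:
  assumes "finite B" "\<And>j. j \<in> J \<Longrightarrow> \<kappa> j \<in> B"
  shows "apply_op B U (superpos J \<alpha> \<kappa>) a = (\<Sum>j\<in>J. U a (\<kappa> j) * complex_of_real (\<alpha> j))"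
proof -
  have "apply_op B U (superpos J \<alpha> \<kappa>) a
      = (\<Sum>j\<in>J. \<Sum>b\<in>B. if b = \<kappa> j then U a b * complex_of_real (\<alpha> j) else 0)"
    unfolding apply_op_def superpos_def
    by (subst sum.swap) (simp add: sum_distrib_left if_distrib cong: if_cong)
  also have "\<dots> = (\<Sum>j\<in>J. U a (\<kappa> j) * complex_of_real (\<alpha> j))"
    using assms by (intro sum.cong refl) simp
  finally show ?thesis .
qed

section \<open>States prepared with a given number of queries\<close>

definition query_idx :: "nat \<Rightarrow> nat \<Rightarrow> (cell \<Rightarrow> sym) \<Rightarrow> idx \<Rightarrow> idx" where
  "query_idx n m x = (\<lambda>(c, p, w). (c, (p + sym_code n m (x (cell_of m c))) mod alph_size n m, w))"

lemma alph_size_pos [simp]: "0 < alph_size n m"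
  by (simp add: alph_size_def)

text \<open>\<open>query_op\<close> pulls amplitudes back along a subtraction,
  \<open>query_idx\<close> pushes labels forward along an addition; this equivalence matches the
  two.\<close>

lemma mod_shift_iff:
  fixes A p p' v :: nat
  assumes "p < A" "p' < A"
  shows "(p + A - v mod A) mod A = p' \<longleftrightarrow> p = (p' + v) mod A"
proof -
  define u where "u = v mod A"
  have u: "u < A" using assms by (simp add: u_def)
  have "(p' + v) mod A = (p' + u) mod A"
    by (simp add: u_def mod_add_right_eq)
  also have "\<dots> = (if p' + u < A then p' + u else p' + u - A)"
    using assms u le_mod_geq[of A "p' + u"] by auto
  finally have 1: "(p' + v) mod A = (if p' + u < A then p' + u else p' + u - A)" .
  have 2: "(p + A - u) mod A = (if u \<le> p then p - u else p + A - u)"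
    using assms u le_mod_geq[of A "p + A - u"] by auto
  show ?thesis unfolding u_def[symmetric] 1 2 using assms u by auto
qed

lemma query_op_superpos:
  assumes "b \<in> basis n m W" "\<And>j. j \<in> J \<Longrightarrow> \<kappa> j \<in> basis n m W"
  shows "query_op n m x (superpos J \<alpha> \<kappa>) b = superpos J \<alpha> (\<lambda>j. query_idx n m x (\<kappa> j)) b"
proof -
  obtain c p w where b: "b = (c, p, w)" by (cases b)
  have "(c, (p + alph_size n m - sym_code n m (x (cell_of m c)) mod alph_size n m) mod alph_size n m, w) = \<kappa> j
     \<longleftrightarrow> (c, p, w) = query_idx n m x (\<kappa> j)" if "j \<in> J" for j
  proof -
    obtain c' p' w' where k: "\<kappa> j = (c', p', w')" by (cases "\<kappa> j")
    show ?thesis using assms(1) assms(2)[OF that]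
      by (auto simp: b k query_idx_def basis_def mod_shift_iff)
  qed
  then show ?thesis
    unfolding b query_op_def superpos_def by (auto intro!: sum.cong)
qed

definition prepares :: "nat \<Rightarrow> nat \<Rightarrow> nat \<Rightarrow> nat \<Rightarrow> ((cell \<Rightarrow> sym) \<Rightarrow> state) \<Rightarrow> bool" where
  "prepares n m W T \<Psi> = (\<exists>Us. length Us = Suc T \<and> (\<forall>U\<in>set Us. unitary_on (basis n m W) U) \<and>
     (\<forall>x. valid_input n m x \<longrightarrow> (\<forall>b\<in>basis n m W. final_state n m W Us x b = \<Psi> x b)))"

lemma prepares_cong:
  assumes "prepares n m W T \<Psi>"
    and "\<And>x b. valid_input n m x \<Longrightarrow> b \<in> basis n m W \<Longrightarrow> \<Psi> x b = \<Phi> x b"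
  shows "prepares n m W T \<Phi>"
proof -
  from assms(1) obtain Us where "length Us = Suc T" "\<forall>U\<in>set Us. unitary_on (basis n m W) U"
    "\<forall>x. valid_input n m x \<longrightarrow> (\<forall>b\<in>basis n m W. final_state n m W Us x b = \<Psi> x b)"
    unfolding prepares_def by blast
  then show ?thesis unfolding prepares_def using assms(2) by (intro exI[of _ Us]) simp
qed

lemma prepares_init:
  assumes "unitary_on (basis n m W) U"
  shows "prepares n m W 0 (\<lambda>x. apply_op (basis n m W) U init_state)"
  unfolding prepares_def
  by (rule exI[of _ "[U]"]) (simp add: assms final_state_def)

text \<open>The format has one unitary between consecutive queries, so a further gate is merged into
  the last one and costs no query.\<close>

lemma prepares_unitary:
  assumes "prepares n m W T \<Psi>" and U: "unitary_on (basis n m W) U"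
  shows "prepares n m W T (\<lambda>x. apply_op (basis n m W) U (\<Psi> x))"
proof -
  let ?B = "basis n m W"
  from assms(1) obtain Us where Us: "length Us = Suc T" "\<forall>U\<in>set Us. unitary_on ?B U"
    "\<And>x b. valid_input n m x \<Longrightarrow> b \<in> ?B \<Longrightarrow> final_state n m W Us x b = \<Psi> x b"
    unfolding prepares_def by blast
  obtain Vs V where V: "Us = Vs @ [V]"
    using Us(1) by (metis append_butlast_last_id length_0_conv nat.distinct(1))
  let ?Us = "Vs @ [comp_op ?B U V]"
  have fin: "final_state n m W ?Us x = apply_op ?B U (final_state n m W Us x)" for x
    by (cases Vs) (simp_all add: final_state_def V apply_comp_op)
  show ?thesis unfolding prepares_def
  proof (rule exI[of _ ?Us], intro conjI allI impI ballI)
    show "length ?Us = Suc T" using Us(1) V by simp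
    show "unitary_on ?B U'" if "U' \<in> set ?Us" for U'
      using that Us(2) V U by (auto intro: unitary_comp_op)
    show "final_state n m W ?Us x b = apply_op ?B U (\<Psi> x) b"
      if "valid_input n m x" "b \<in> ?B" for x b
      unfolding fin using Us(3)[OF that(1)] by (auto simp: apply_op_def intro!: sum.cong)
  qed
qed

lemma prepares_query:
  assumes "prepares n m W T \<Psi>"
  shows "prepares n m W (Suc T) (\<lambda>x. query_op n m x (\<Psi> x))"
proof -
  let ?B = "basis n m W"
  from assms(1) obtain Us where Us: "length Us = Suc T" "\<forall>U\<in>set Us. unitary_on ?B U"
    "\<And>x b. valid_input n m x \<Longrightarrow> b \<in> ?B \<Longrightarrow> final_state n m W Us x b = \<Psi> x b"
    unfolding prepares_def by blast
  \<comment> \<open>An algorithm ends with a gate, not with a query; the identity fills that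
    slot.\<close>
  let ?Us = "Us @ [perm_op id]"
  have ne: "Us \<noteq> []" using Us(1) by auto
  have fin: "final_state n m W ?Us x b = query_op n m x (final_state n m W Us x) b"
    if "b \<in> ?B" for x b
    using ne that by (simp add: final_state_def perm_op_id)
  show ?thesis unfolding prepares_def
  proof (rule exI[of _ ?Us], intro conjI allI impI ballI)
    show "length ?Us = Suc (Suc T)" using Us(1) by simp
    show "unitary_on ?B U'" if "U' \<in> set ?Us" for U'
      using that Us(2) by (auto intro: unitary_perm_op)
    show "final_state n m W ?Us x b = query_op n m x (\<Psi> x) b"
      if v: "valid_input n m x" and b: "b \<in> ?B" for x b
    proof -
      obtain c p w where cpw: "b = (c, p, w)" by (cases b)
      have "(c, (p + alph_size n m - sym_code n m (x (cell_of m c)) mod alph_size n m) mod alph_size n m, w) \<in> ?B"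
        using b by (auto simp: cpw basis_def)
      then show ?thesis
        unfolding fin[OF b] using Us(3)[OF v] by (simp add: query_op_def cpw)
    qed
  qed
qed

lemma prepares_superpos_query:
  assumes "prepares n m W T (\<lambda>x. superpos J (\<alpha> x) (\<kappa> x))"
    and "\<And>x j. valid_input n m x \<Longrightarrow> j \<in> J \<Longrightarrow> \<kappa> x j \<in> basis n m W"
  shows "prepares n m W (Suc T) (\<lambda>x. superpos J (\<alpha> x) (\<lambda>j. query_idx n m x (\<kappa> x j)))"
  by (rule prepares_cong[OF prepares_query[OF assms(1)]]) (auto intro!: query_op_superpos assms(2))

text \<open>The permutation may not depend on the input, so \<open>A\<close> has to contain the
  labels of all inputs at once.\<close>

lemma prepares_superpos_inj:
  assumes prep: "prepares n m W T (\<lambda>x. superpos J (\<alpha> x) (\<kappa> x))"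
    and \<kappa>: "\<And>x j. valid_input n m x \<Longrightarrow> j \<in> J \<Longrightarrow> \<kappa> x j \<in> A"
    and f: "A \<subseteq> basis n m W" "inj_on f A" "f ` A \<subseteq> basis n m W"
  shows "prepares n m W T (\<lambda>x. superpos J (\<alpha> x) (\<lambda>j. f (\<kappa> x j)))"
proof -
  obtain g where g: "bij_betw g (basis n m W) (basis n m W)" "\<And>a. a \<in> A \<Longrightarrow> g a = f a"
    using extend_to_permutation[OF finite_basis f] by blast
  show ?thesis
  proof (rule prepares_cong[OF prepares_unitary[OF prep unitary_perm_op[OF finite_basis g(1)]]])
    fix x b assume v: "valid_input n m x"
    show "apply_op (basis n m W) (perm_op g) (superpos J (\<alpha> x) (\<kappa> x)) b = superpos J (\<alpha> x) (\<lambda>j. f (\<kappa> x j)) b"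
      using \<kappa>[OF v] f(1) g(2) by (subst apply_superpos) (auto simp: superpos_def perm_op_def intro!: sum.cong)
  qed
qed

lemma prepares_superpos_diag:
  assumes prep: "prepares n m W T (\<lambda>x. superpos J (\<alpha> x) (\<kappa> x))"
    and \<kappa>: "\<And>x j. valid_input n m x \<Longrightarrow> j \<in> J \<Longrightarrow> \<kappa> x j \<in> basis n m W"
    and s: "\<And>a. s a * s a = 1"
  shows "prepares n m W T (\<lambda>x. superpos J (\<lambda>j. s (\<kappa> x j) * \<alpha> x j) (\<kappa> x))"
proof (rule prepares_cong[OF prepares_unitary[OF prep unitary_diag_op[OF finite_basis s]]])
  fix x b assume v: "valid_input n m x"
  show "apply_op (basis n m W) (diag_op s) (superpos J (\<alpha> x) (\<kappa> x)) b = superpos J (\<lambda>j. s (\<kappa> x j) * \<alpha> x j) (\<kappa> x) b"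
    using \<kappa>[OF v] by (subst apply_superpos) (auto simp: superpos_def diag_op_def intro!: sum.cong)
qed

section \<open>Reflections in superpositions of labels\<close>

definition amp_vec :: "nat set \<Rightarrow> (nat \<Rightarrow> real) \<Rightarrow> (nat \<Rightarrow> idx) \<Rightarrow> idx \<Rightarrow> real" where
  "amp_vec J \<psi> \<kappa> = (\<lambda>a. \<Sum>j\<in>J. if a = \<kappa> j then \<psi> j else 0)"

lemma amp_vec_at:
  assumes "finite J" "inj_on \<kappa> J" "j \<in> J"
  shows "amp_vec J \<psi> \<kappa> (\<kappa> j) = \<psi> j"
proof -
  have "amp_vec J \<psi> \<kappa> (\<kappa> j) = (\<Sum>i\<in>J. if i = j then \<psi> i else 0)"
    unfolding amp_vec_def using assms by (intro sum.cong) (auto simp: inj_on_eq_iff)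
  then show ?thesis using assms by simp
qed

lemma sum_amp_vec:
  assumes "finite B" "\<kappa> ` J \<subseteq> B"
  shows "(\<Sum>a\<in>B. amp_vec J \<psi> \<kappa> a * F a) = (\<Sum>j\<in>J. \<psi> j * F (\<kappa> j))"
proof -
  have "(\<Sum>a\<in>B. amp_vec J \<psi> \<kappa> a * F a) = (\<Sum>a\<in>B. \<Sum>j\<in>J. if a = \<kappa> j then \<psi> j * F a else 0)"
    unfolding amp_vec_def sum_distrib_right by (intro sum.cong refl) simp
  also have "\<dots> = (\<Sum>j\<in>J. \<Sum>a\<in>B. if a = \<kappa> j then \<psi> j * F a else 0)"
    by (rule sum.swap)
  also have "\<dots> = (\<Sum>j\<in>J. \<psi> j * F (\<kappa> j))"
    using assms by (intro sum.cong refl) (simp add: image_subset_iff)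
  finally show ?thesis .
qed

text \<open>This is I - 2 |u><u| with u the superposition of the labels with weights \<psi>, the
  negative of the usual Grover diffusion. Injectivity of \<kappa> lets inner products with u be
  computed on labels.\<close>

lemma prepares_superpos_refl:
  assumes prep: "prepares n m W T (\<lambda>x. superpos J (\<alpha> x) \<kappa>)"
    and J: "finite J" "inj_on \<kappa> J" "\<kappa> ` J \<subseteq> basis n m W" "(\<Sum>j\<in>J. \<psi> j * \<psi> j) = 1"
  shows "prepares n m W T (\<lambda>x. superpos J (\<lambda>j. \<alpha> x j - 2 * \<psi> j * (\<Sum>i\<in>J. \<psi> i * \<alpha> x i)) \<kappa>)"
proof -
  let ?B = "basis n m W" and ?u = "amp_vec J \<psi> \<kappa>"
  have "(\<Sum>a\<in>?B. ?u a * ?u a) = 1"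
    using J by (simp add: sum_amp_vec amp_vec_at)
  then have uni: "unitary_on ?B (refl_op ?u)" by (simp add: unitary_refl_op)
  show ?thesis
  proof (rule prepares_cong[OF prepares_unitary[OF prep uni]])
    fix x b
    let ?S = "\<Sum>i\<in>J. \<psi> i * \<alpha> x i"
    have "apply_op ?B (refl_op ?u) (superpos J (\<alpha> x) \<kappa>) b = (\<Sum>j\<in>J. refl_op ?u b (\<kappa> j) * complex_of_real (\<alpha> x j))"
      using J by (intro apply_superpos) auto
    also have "\<dots> = complex_of_real (\<Sum>j\<in>J. (if b = \<kappa> j then \<alpha> x j else 0) - 2 * ?u b * (\<psi> j * \<alpha> x j))"
      using J by (simp add: refl_op_def amp_vec_at algebra_simps flip: of_real_mult cong: sum.cong)
         (auto intro!: sum.cong simp: algebra_simps)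
    also have "(\<Sum>j\<in>J. (if b = \<kappa> j then \<alpha> x j else 0) - 2 * ?u b * (\<psi> j * \<alpha> x j))
        = (\<Sum>j\<in>J. if b = \<kappa> j then \<alpha> x j else 0) - 2 * ?u b * ?S"
      by (simp add: sum_subtractf sum_distrib_left)
    also have "\<dots> = (\<Sum>j\<in>J. if b = \<kappa> j then \<alpha> x j - 2 * \<psi> j * ?S else 0)"
    proof -
      have "2 * ?u b * ?S = (\<Sum>j\<in>J. if b = \<kappa> j then 2 * \<psi> j * ?S else 0)"
        unfolding amp_vec_def sum_distrib_left[of 2] sum_distrib_right[of _ J ?S] by (intro sum.cong refl) simp
      then show ?thesis by (auto simp flip: sum_subtractf intro!: sum.cong)
    qed
    finally show "apply_op ?B (refl_op ?u) (superpos J (\<alpha> x) \<kappa>) b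
        = superpos J (\<lambda>j. \<alpha> x j - 2 * \<psi> j * ?S) \<kappa> b"
      unfolding superpos_def by (simp add: of_real_sum if_distrib cong: if_cong)
  qed
qed

text \<open>The reflection in the hyperplane orthogonal to the difference of two orthogonal unit vectors exchanges them.\<close>

lemma prepares_superpos_start:
  assumes J: "finite J" "inj_on \<kappa> J" "\<kappa> ` J \<subseteq> basis n m W" "(\<Sum>j\<in>J. \<psi> j * \<psi> j) = 1"
    and 0: "(0, 0, 0) \<in> basis n m W" "(0, 0, 0) \<notin> \<kappa> ` J"
  shows "prepares n m W 0 (\<lambda>x. superpos J \<psi> \<kappa>)"
proof -
  let ?B = "basis n m W" and ?u = "amp_vec J \<psi> \<kappa>" and ?o = "(0, 0, 0) :: idx"
  define v where "v = (\<lambda>a. ((if a = ?o then 1 else 0) - ?u a) / sqrt 2)"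
  have u0: "?u ?o = 0" using 0 by (auto simp: amp_vec_def intro!: sum.neutral)
  have uu: "(\<Sum>a\<in>?B. ?u a * ?u a) = 1"
    using J by (simp add: sum_amp_vec amp_vec_at)
  have "(\<Sum>a\<in>?B. v a * v a) = (\<Sum>a\<in>?B. (if a = ?o then 1 / 2 else 0) + ?u a * ?u a / 2)"
    by (rule sum.cong) (auto simp: v_def u0)
  also have "\<dots> = 1"
    using 0 uu by (simp add: sum.distrib flip: sum_divide_distrib)
  finally have uni: "unitary_on ?B (refl_op v)" by (simp add: unitary_refl_op)
  show ?thesis
  proof (rule prepares_cong[OF prepares_init[OF uni]])
    fix x b
    have "apply_op ?B (refl_op v) init_state b = refl_op v b ?o"
      using 0 by (simp add: apply_op_def init_state_def if_distrib[of "\<lambda>t. _ * t"] cong: if_cong)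
    also have "\<dots> = complex_of_real (?u b)"
    proof -
      have "(if b = ?o then 1 else 0) - 2 * v b * v ?o = ?u b"
        by (auto simp: v_def u0)
      then show ?thesis unfolding refl_op_def by (simp only:)
    qed
    finally show "apply_op ?B (refl_op v) init_state b = superpos J \<psi> \<kappa> b"
      by (simp add: amp_vec_def superpos_def of_real_sum if_distrib cong: if_cong)
  qed
qed

section \<open>Symbol codes and cell indices\<close>

definition valid_syms :: "nat \<Rightarrow> nat \<Rightarrow> sym set" where
  "valid_syms n m = {s. valid_ptr n m (lpoint s) \<and> valid_ptr n m (rpoint s) \<and> valid_ptr n m (ipoint s)}"

definition cell_idx :: "nat \<Rightarrow> cell \<Rightarrow> nat" where
  "cell_idx m c = (fst c - 1) * m + (snd c - 1)"

lemma cell_idx_less: "c \<in> cells n m \<Longrightarrow> cell_idx m c < n * m"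
proof -
  assume "c \<in> cells n m"
  then have 1: "fst c - 1 \<le> n - 1" "snd c - 1 < m" "n \<ge> 1" by (auto simp: cells_def)
  have "(fst c - 1) * m + (snd c - 1) < (fst c - 1) * m + m" using 1 by simp
  also have "\<dots> = Suc (fst c - 1) * m" by simp
  also have "\<dots> \<le> n * m" using 1 by (intro mult_le_mono1) linarith
  finally show ?thesis by (simp add: cell_idx_def)
qed

lemma cell_of_idx: "c \<in> cells n m \<Longrightarrow> cell_of m (cell_idx m c) = c"
proof -
  assume "c \<in> cells n m"
  then obtain i j where "c = (Suc i, Suc j)" "j < m"
    by (cases c; cases "fst c"; cases "snd c") (auto simp: cells_def)
  then show ?thesis by (simp add: cell_of_def cell_idx_def)
qed

lemma ptr_code_alt: "ptr_code m p = (case p of None \<Rightarrow> 0 | Some c \<Rightarrow> Suc (cell_idx m c))"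
  by (auto simp: ptr_code_def cell_idx_def split: option.split)

lemma ptr_code_less: "valid_ptr n m p \<Longrightarrow> ptr_code m p < n * m + 1"
  by (auto simp: valid_ptr_def ptr_code_alt cell_idx_less split: option.splits)

lemma ptr_code_inj:
  assumes "valid_ptr n m p" "valid_ptr n m q" "ptr_code m p = ptr_code m q"
  shows "p = q"
proof (cases p)
  case None
  then show ?thesis using assms by (auto simp: ptr_code_alt split: option.splits)
next
  case (Some c)
  then obtain d where d: "q = Some d" "cell_idx m c = cell_idx m d"
    using assms by (auto simp: ptr_code_alt split: option.splits)
  moreover have "c \<in> cells n m" "d \<in> cells n m"
    using assms Some d by (simp_all add: valid_ptr_def)
  ultimately show ?thesis using Some cell_of_idx by metis
qed

lemma digits_unique:
  fixes a b c d M :: nat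
  assumes "a + M * b = c + M * d" "a < M" "c < M"
  shows "a = c \<and> b = d"
proof -
  have "(a + M * b) mod M = a" "(c + M * d) mod M = c" using assms(2,3) by simp_all
  then have "a = c" unfolding assms(1) by simp
  then show ?thesis using assms by simp
qed

lemma digits_less:
  fixes a b M N :: nat
  assumes "a < M" "b < N"
  shows "a + M * b < M * N"
proof -
  have "a + M * b < M + M * b" using assms by simp
  also have "\<dots> = M * Suc b" by simp
  also have "\<dots> \<le> M * N" using assms by (intro mult_le_mono2) simp
  finally show ?thesis .
qed

lemma sym_code_inj: "inj_on (sym_code n m) (valid_syms n m)"
proof
  fix s t assume s: "s \<in> valid_syms n m" and t: "t \<in> valid_syms n m" and eq: "sym_code n m s = sym_code n m t"
  let ?P = "ptr_code m"
  have lt: "?P (lpoint s) < n * m + 1" "?P (rpoint s) < n * m + 1"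
     "?P (lpoint t) < n * m + 1" "?P (rpoint t) < n * m + 1"
    using s t by (auto simp: valid_syms_def intro!: ptr_code_less[unfolded Suc_eq_plus1[symmetric]])
  have v: "(if val s then 1 else 0) = (if val t then 1 else (0::nat))" and "?P (lpoint s) + (n * m + 1) * (?P (rpoint s) + (n * m + 1) * ?P (ipoint s))
      = ?P (lpoint t) + (n * m + 1) * (?P (rpoint t) + (n * m + 1) * ?P (ipoint t))"
    using digits_unique[OF eq[unfolded sym_code_def]] by simp_all
  then have l: "?P (lpoint s) = ?P (lpoint t)"
    and "?P (rpoint s) + (n * m + 1) * ?P (ipoint s) = ?P (rpoint t) + (n * m + 1) * ?P (ipoint t)"
    using digits_unique lt(1,3) by blast+
  then have r: "?P (rpoint s) = ?P (rpoint t)" and i: "?P (ipoint s) = ?P (ipoint t)"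
    using digits_unique lt(2,4) by blast+
  have "lpoint s = lpoint t" "rpoint s = rpoint t" "ipoint s = ipoint t"
    using s t l r i by (auto simp: valid_syms_def intro: ptr_code_inj)
  moreover have "val s = val t" using v by (simp split: if_splits)
  ultimately show "s = t"
    by (simp add: prod_eq_iff val_def lpoint_def rpoint_def ipoint_def)
qed

lemma sym_code_less:
  assumes "s \<in> valid_syms n m"
  shows "sym_code n m s < alph_size n m"
proof -
  have "ptr_code m (lpoint s) < n * m + 1" "ptr_code m (rpoint s) < n * m + 1" "ptr_code m (ipoint s) < n * m + 1"
    using assms ptr_code_less unfolding valid_syms_def by blast+
  then have "sym_code n m s < 2 * ((n * m + 1) * ((n * m + 1) * (n * m + 1)))"
    unfolding sym_code_def by (intro digits_less) auto
  then show ?thesis by (simp add: alph_size_def power3_eq_cube algebra_simps)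
qed

text \<open>The value is the lowest digit of the code, so a column can be tested by the parities of
  the raw answers.\<close>

lemma odd_sym_code: "odd (sym_code n m s) \<longleftrightarrow> val s"
  by (simp add: sym_code_def)

lemma valid_input_syms: "valid_input n m x \<Longrightarrow> c \<in> cells n m \<Longrightarrow> x c \<in> valid_syms n m"
  by (auto simp: valid_input_def valid_syms_def)

section \<open>Classical query strategies run in superposition\<close>

text \<open>
  A history lists the received answers, newest first, above the starting index;
  the strategy \<open>strat\<close> sees the starting index, the time and the cells known so far.
\<close>

locale query_strategy =
  fixes n m :: nat and strat :: "nat \<Rightarrow> nat \<Rightarrow> (cell \<rightharpoonup> sym) \<Rightarrow> cell"
  assumes strat_cells: "strat b t K \<in> cells n m"
begin

abbreviation "decode_sym \<equiv> inv_into (valid_syms n m) (sym_code n m)"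

text \<open>The bottom entry of a history is the start index, not an answer; hence the case
  \<open>H = []\<close>, and \<open>length H - 1\<close> is the number of answers in
  \<open>H\<close>.\<close>

fun known :: "nat list \<Rightarrow> cell \<rightharpoonup> sym" where
  "known [] = Map.empty"
| "known (v # H) = (if H = [] then Map.empty
     else (known H)(strat (last H) (length H - 1) (known H) \<mapsto> decode_sym v))"

definition next_cell :: "nat list \<Rightarrow> cell" where
  "next_cell H = strat (last H) (length H - 1) (known H)"

definition answer :: "(cell \<Rightarrow> sym) \<Rightarrow> nat list \<Rightarrow> nat" where
  "answer x H = sym_code n m (x (next_cell H))"

fun hist :: "(cell \<Rightarrow> sym) \<Rightarrow> nat \<Rightarrow> nat \<Rightarrow> nat list" where
  "hist x 0 j = [j]"
| "hist x (Suc t) j = answer x (hist x t j) # hist x t j"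

text \<open>The cell register already holds the next cell and the answer register is cleared, so a
  query can follow at once. The triple is a function of the history, which its last component
  encodes.\<close>

definition conf :: "nat list \<Rightarrow> idx" where
  "conf H = (cell_idx m (next_cell H), 0, list_encode H)"

text \<open>Entries are answers below \<open>alph_size n m\<close> or a start index up to
  \<open>m\<close>; the sum bounds both and makes the set finite.\<close>

definition histories :: "nat \<Rightarrow> nat list set" where
  "histories L = {H. set H \<subseteq> {..<alph_size n m + Suc m} \<and> length H \<le> Suc L}"

definition work_dim :: "nat \<Rightarrow> nat" where
  "work_dim L = Suc (Max (list_encode ` histories L))"

abbreviation "hbasis L \<equiv> basis n m (work_dim L)"

lemma next_cell_cells: "next_cell H \<in> cells n m"
  by (simp add: next_cell_def strat_cells)

lemma hist_nonempty [simp]: "hist x t j \<noteq> []"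
  by (cases t) simp_all

lemma last_hist [simp]: "last (hist x t j) = j"
  by (induction t) simp_all

lemma length_hist [simp]: "length (hist x t j) = Suc t"
  by (induction t) simp_all

lemma known_hist_Suc:
  "known (hist x (Suc t) j) = (known (hist x t j))(next_cell (hist x t j) \<mapsto> decode_sym (answer x (hist x t j)))"
  by (simp add: next_cell_def)

lemma answer_less: "valid_input n m x \<Longrightarrow> answer x H < alph_size n m"
  by (auto simp: answer_def next_cell_cells valid_input_syms intro!: sym_code_less)

lemma decode_answer: "valid_input n m x \<Longrightarrow> decode_sym (answer x H) = x (next_cell H)"
  by (simp add: answer_def next_cell_cells valid_input_syms sym_code_inj)

lemma finite_histories: "finite (histories L)"
  unfolding histories_def by (rule finite_lists_length_le) simp

lemma encode_less: "H \<in> histories L \<Longrightarrow> list_encode H < work_dim L"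
  unfolding work_dim_def less_Suc_eq_le by (intro Max_ge) (auto simp: finite_histories)

lemma hist_in_histories:
  assumes "valid_input n m x" "j \<le> m" "t \<le> L"
  shows "hist x t j \<in> histories L"
proof -
  have "set (hist x t j) \<subseteq> {..<alph_size n m + Suc m}"
    using answer_less[OF assms(1)] assms(2) by (induction t) (auto intro: less_trans[OF _ less_add_Suc1])
  then show ?thesis using assms by (simp add: histories_def)
qed

lemma idx_in_hbasis: "p < alph_size n m \<Longrightarrow> H \<in> histories L \<Longrightarrow> (cell_idx m (next_cell H'), p, list_encode H) \<in> hbasis L"
  by (simp add: basis_def encode_less cell_idx_less next_cell_cells)

lemma conf_in_hbasis: "H \<in> histories L \<Longrightarrow> conf H \<in> hbasis L"
  by (simp add: conf_def idx_in_hbasis)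

lemma conf_inj: "conf H = conf H' \<longleftrightarrow> H = H'"
  by (auto simp: conf_def dest: injD[OF inj_list_encode])

lemma tl_histories: "v # H \<in> histories L \<Longrightarrow> H \<in> histories L"
  by (auto simp: histories_def)

text \<open>After the query the answer register holds \<open>v\<close>; \<open>f\<close> moves it
  onto the history and addresses the next cell. The old triple is determined by
  \<open>v # H\<close>, so \<open>f\<close> is injective on \<open>A\<close>.\<close>

lemma forward_step:
  assumes prep: "prepares n m (work_dim L) T (\<lambda>x. superpos {..m} (\<alpha> x) (\<lambda>j. conf (hist x t j)))"
    and t: "t < L"
  shows "prepares n m (work_dim L) (Suc T) (\<lambda>x. superpos {..m} (\<alpha> x) (\<lambda>j. conf (hist x (Suc t) j)))"
proof -
  define A where "A = {(cell_idx m (next_cell H), v, list_encode H) |v H. v < alph_size n m \<and> v # H \<in> histories L}"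
  define f where "f = (\<lambda>(c::nat, v, w). conf (v # list_decode w))"
  have q: "query_idx n m x (conf (hist x t j))
      = (cell_idx m (next_cell (hist x t j)), answer x (hist x t j), list_encode (hist x t j))"
    if "valid_input n m x" for x j
    using answer_less[OF that, of "hist x t j"]
    by (simp add: query_idx_def conf_def answer_def cell_of_idx[OF next_cell_cells])
  have "prepares n m (work_dim L) (Suc T)
     (\<lambda>x. superpos {..m} (\<alpha> x) (\<lambda>j. f (query_idx n m x (conf (hist x t j)))))"
  proof (rule prepares_superpos_inj[OF prepares_superpos_query[OF prep]])
    show "conf (hist x t j) \<in> hbasis L" if "valid_input n m x" "j \<in> {..m}" for x j
      using that t by (intro conf_in_hbasis hist_in_histories) auto
    show "query_idx n m x (conf (hist x t j)) \<in> A" if "valid_input n m x" "j \<in> {..m}" for x j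
      using q[OF that(1)] answer_less[OF that(1)] hist_in_histories[of x j "Suc t" L] that t
      by (auto simp: A_def)
    show "A \<subseteq> hbasis L" by (auto simp: A_def intro!: idx_in_hbasis dest: tl_histories)
    show "f ` A \<subseteq> hbasis L" by (auto simp: A_def f_def intro!: conf_in_hbasis)
    show "inj_on f A" by (auto simp: inj_on_def A_def f_def conf_inj)
  qed
  then show ?thesis
    by (rule prepares_cong) (auto simp: superpos_def q f_def intro!: sum.cong)
qed

lemma forward:
  assumes "prepares n m (work_dim L) T (\<lambda>x. superpos {..m} (\<alpha> x) (\<lambda>j. conf [j]))" "t \<le> L"
  shows "prepares n m (work_dim L) (T + t) (\<lambda>x. superpos {..m} (\<alpha> x) (\<lambda>j. conf (hist x t j)))"
  using assms(2)
proof (induction t)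
  case 0
  then show ?case using assms(1) by simp
next
  case (Suc t)
  then show ?case using forward_step[of L "T + t" \<alpha> t] by simp
qed

text \<open>Presetting the answer register to minus the last answer makes the query erase that answer.\<close>

lemma backward_step:
  assumes prep: "prepares n m (work_dim L) T (\<lambda>x. superpos {..m} (\<alpha> x) (\<lambda>j. conf (hist x (Suc t) j)))"
    and t: "t < L"
  shows "prepares n m (work_dim L) (Suc T) (\<lambda>x. superpos {..m} (\<alpha> x) (\<lambda>j. conf (hist x t j)))"
proof -
  define A where "A = {conf (v # H) |v H. v < alph_size n m \<and> v # H \<in> histories L}"
  define g where "g = (\<lambda>v H. (cell_idx m (next_cell H), (alph_size n m - v) mod alph_size n m, list_encode H))"
  define f where "f = (\<lambda>(c::nat, p::nat, w). g (hd (list_decode w)) (tl (list_decode w)))"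
  have fconf: "f (conf (v # H)) = g v H" for v H
    by (simp add: f_def conf_def del: list_encode.simps)
  have inj: "v = v'" if "v < a" "v' < a" "(a - v) mod a = (a - v') mod a" for v v' a :: nat
    using that by (cases "v = 0"; cases "v' = 0") auto
  have q: "query_idx n m x (g (answer x H) H) = conf H" if "valid_input n m x" for x H
    using answer_less[OF that, of H]
    by (simp add: query_idx_def conf_def g_def answer_def cell_of_idx[OF next_cell_cells] mod_add_left_eq)
  have fA: "f ` A \<subseteq> hbasis L"
    by (auto simp: A_def fconf) (auto simp: g_def intro!: idx_in_hbasis dest: tl_histories)
  have 1: "conf (hist x (Suc t) j) \<in> A" if "valid_input n m x" "j \<in> {..m}" for x j
    using answer_less[OF that(1)] hist_in_histories[of x j "Suc t" L] that t
    by (auto simp: A_def)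
  have "prepares n m (work_dim L) (Suc T)
     (\<lambda>x. superpos {..m} (\<alpha> x) (\<lambda>j. query_idx n m x (f (conf (hist x (Suc t) j)))))"
  proof (rule prepares_superpos_query[OF prepares_superpos_inj[OF prep 1 _ _ fA]])
    show "A \<subseteq> hbasis L" by (auto simp: A_def intro!: conf_in_hbasis)
    show "inj_on f A"
    proof (rule inj_onI)
      fix a b assume "a \<in> A" "b \<in> A" and eq: "f a = f b"
      then obtain v H v' H' where "a = conf (v # H)" "v < alph_size n m" "b = conf (v' # H')" "v' < alph_size n m"
        by (auto simp: A_def)
      then show "a = b" using eq by (auto simp: fconf g_def dest: inj injD[OF inj_list_encode])
    qed
    show "f (conf (hist x (Suc t) j)) \<in> hbasis L" if "valid_input n m x" "j \<in> {..m}" for x j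
      using fA 1[OF that] by blast
  qed auto
  then show ?thesis
    by (rule prepares_cong) (simp add: superpos_def q fconf)
qed

lemma backward:
  assumes "prepares n m (work_dim L) T (\<lambda>x. superpos {..m} (\<alpha> x) (\<lambda>j. conf (hist x t j)))" "t \<le> L"
  shows "prepares n m (work_dim L) (T + t) (\<lambda>x. superpos {..m} (\<alpha> x) (\<lambda>j. conf [j]))"
  using assms
proof (induction t arbitrary: T)
  case 0
  then show ?case by simp
next
  case (Suc t)
  then show ?case using Suc.IH[OF backward_step[of L T \<alpha> t]] by simp
qed

text \<open>Compute the history, flip the sign, uncompute. \<open>good\<close> may be any predicate
  of the history, since a diagonal gate costs no query.\<close>

lemma phase_flip:
  assumes prep: "prepares n m (work_dim L) T (\<lambda>x. superpos {..m} (\<alpha> x) (\<lambda>j. conf [j]))" and t: "t \<le> L"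
  shows "prepares n m (work_dim L) (T + 2 * t)
    (\<lambda>x. superpos {..m} (\<lambda>j. (if good (hist x t j) then -1 else 1) * \<alpha> x j) (\<lambda>j. conf [j]))"
proof -
  define s where "s = (\<lambda>(c::nat, p::nat, w). if good (list_decode w) then -1 else (1::real))"
  have 1: "s a * s a = 1" for a by (auto simp: s_def split: prod.split)
  have 2: "conf (hist x t j) \<in> hbasis L" if "valid_input n m x" "j \<in> {..m}" for x j
    using that t by (intro conf_in_hbasis hist_in_histories) auto
  have "prepares n m (work_dim L) (T + t)
    (\<lambda>x. superpos {..m} (\<lambda>j. s (conf (hist x t j)) * \<alpha> x j) (\<lambda>j. conf (hist x t j)))"
    by (rule prepares_superpos_diag[OF forward[OF prep t] 2 1])
  moreover have "s (conf H) = (if good H then -1 else 1)" for H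
    by (simp add: s_def conf_def del: list_encode.simps)
  ultimately show ?thesis
    using backward[of L "T + t" _ t] t by (simp add: mult_2 add.assoc)
qed

section \<open>Rotation of the amplitudes\<close>

fun grover :: "nat set \<Rightarrow> (nat \<Rightarrow> real) \<Rightarrow> nat \<Rightarrow> nat \<Rightarrow> real" where
  "grover G \<psi> 0 = \<psi>"
| "grover G \<psi> (Suc r) = (\<lambda>j. (if j \<in> G then -1 else 1) * grover G \<psi> r j
     - 2 * \<psi> j * (\<Sum>i\<le>m. \<psi> i * ((if i \<in> G then -1 else 1) * grover G \<psi> r i)))"

lemma prepares_grover:
  assumes "t \<le> L" and \<psi>: "(\<Sum>j\<le>m. \<psi> j * \<psi> j) = 1"
  shows "prepares n m (work_dim L) (r * (2 * t))
    (\<lambda>x. superpos {..m} (grover {j. good (hist x t j)} \<psi> r) (\<lambda>j. conf [j]))"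
proof (induction r)
  have J: "inj_on (\<lambda>j. conf [j]) {..m}" "(\<lambda>j. conf [j]) ` {..m} \<subseteq> hbasis L"
    by (auto simp: inj_on_def conf_inj histories_def intro!: conf_in_hbasis)
  {
    case 0
    \<comment> \<open>The code of the empty history is 0 and that of \<open>[j]\<close> is positive,
      so the initial basis state is orthogonal to the start superposition.\<close>
    have "[] \<in> histories L" by (simp add: histories_def)
    then have "(0, 0, 0) \<in> hbasis L"
      using encode_less[of "[]" L] cell_idx_less[OF next_cell_cells[of "[]"]] by (cases "n * m") (auto simp: basis_def)
    moreover have "(0, 0, 0) \<notin> (\<lambda>j. conf [j]) ` {..m}"
      by (auto simp: conf_def)
    ultimately show ?case using prepares_superpos_start[OF _ J \<psi>] by simp
  next
    case (Suc r)
    show ?case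
      using prepares_superpos_refl[OF phase_flip[OF Suc assms(1), where good=good] _ J \<psi>]
      by (simp add: add.commute)
  }
qed

text \<open>\<open>accept\<close> quantifies over all inputs consistent with the history, which is
  allowed because only queries are counted. A negative input is consistent with its own histories
  and so refutes acceptance; what remains are positive inputs, on branches of nonzero
  amplitude.\<close>

lemma exact_alg_grover:
  assumes "t \<le> L" "(\<Sum>j\<le>m. \<psi> j * \<psi> j) = 1"
    and cert: "\<And>x x' j. valid_input n m x \<Longrightarrow> f x \<Longrightarrow> j \<le> m \<Longrightarrow> grover {j. good (hist x t j)} \<psi> r j \<noteq> 0 \<Longrightarrow>
      valid_input n m x' \<Longrightarrow> hist x' L j = hist x L j \<Longrightarrow> f x'"
  shows "exact_alg n m f (r * (2 * t) + L)"
proof -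
  define accept where "accept = (\<lambda>H. \<forall>x. valid_input n m x \<and> hist x L (last H) = H \<longrightarrow> f x)"
  let ?out = "\<lambda>(c::nat, p::nat, w). accept (list_decode w)"
  let ?\<alpha> = "\<lambda>x. grover {j. good (hist x t j)} \<psi> r"
  obtain Us where Us: "length Us = Suc (r * (2 * t) + L)" "\<forall>U\<in>set Us. unitary_on (hbasis L) U"
    "\<And>x b. valid_input n m x \<Longrightarrow> b \<in> hbasis L \<Longrightarrow>
       final_state n m (work_dim L) Us x b = superpos {..m} (?\<alpha> x) (\<lambda>j. conf (hist x L j)) b"
    using forward[OF prepares_grover[OF assms(1,2), where r=r and good=good], of L] unfolding prepares_def by blast
  have "superpos {..m} (?\<alpha> x) (\<lambda>j. conf (hist x L j)) b = 0"
    if x: "valid_input n m x" and b: "?out b \<noteq> f x" for x b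
    unfolding superpos_def
  proof (intro sum.neutral ballI)
    fix j assume j: "j \<in> {..m}"
    have "?\<alpha> x j = 0" if "b = conf (hist x L j)"
    proof (rule ccontr)
      assume nz: "?\<alpha> x j \<noteq> 0"
      have "accept (hist x L j) \<noteq> f x" using b that by (simp add: conf_def)
      then show False using cert[OF x _ _ nz] x j unfolding accept_def by auto
    qed
    then show "(if b = conf (hist x L j) then complex_of_real (?\<alpha> x j) else 0) = 0" by simp
  qed
  then show ?thesis
    unfolding exact_alg_def using Us
    by (intro exI[of _ "work_dim L"] conjI exI[of _ Us] exI[of _ ?out]) (auto simp: work_dim_def)
qed

text \<open>Each round rotates by 2 \<theta> in the plane spanned by the marked and the unmarked
  part of \<psi>. The sign \<open>(-1) ^ r\<close> comes from reflecting with I - 2 |u><u| instead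
  of its negative.\<close>

lemma grover_closed_form:
  assumes G: "G \<subseteq> {..m}" "(\<Sum>j\<in>G. \<psi> j * \<psi> j) = (sin \<theta>)\<^sup>2" "(\<Sum>j\<le>m. \<psi> j * \<psi> j) = 1"
    and nz: "sin \<theta> \<noteq> 0" "cos \<theta> \<noteq> 0" and "j \<le> m"
  shows "grover G \<psi> r j = (-1) ^ r * \<psi> j *
    (if j \<in> G then sin ((2 * real r + 1) * \<theta>) / sin \<theta> else cos ((2 * real r + 1) * \<theta>) / cos \<theta>)"
  using \<open>j \<le> m\<close>
proof (induction r arbitrary: j)
  case 0
  then show ?case using nz by simp
next
  case (Suc r)
  let ?\<phi> = "(2 * real r + 1) * \<theta>"
  have split: "(\<Sum>i\<le>m. F i) = (\<Sum>i\<in>G. F i) + (\<Sum>i\<in>{..m} - G. F i)" for F :: "nat \<Rightarrow> real"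
    using sum.subset_diff[OF G(1), of F] by simp
  have bad: "(\<Sum>j\<in>{..m} - G. \<psi> j * \<psi> j) = (cos \<theta>)\<^sup>2"
    using split[of "\<lambda>j. \<psi> j * \<psi> j"] unfolding G(2,3) cos_squared_eq by linarith
  have "(\<Sum>i\<le>m. \<psi> i * ((if i \<in> G then -1 else 1) * grover G \<psi> r i))
      = (\<Sum>i\<in>G. (-1) ^ r * (- sin ?\<phi> / sin \<theta>) * (\<psi> i * \<psi> i))
        + (\<Sum>i\<in>{..m} - G. (-1) ^ r * (cos ?\<phi> / cos \<theta>) * (\<psi> i * \<psi> i))"
    unfolding split by (intro arg_cong2[where f = "(+)"] sum.cong refl) (use Suc.IH G(1) in auto)
  also have "\<dots> = (-1) ^ r * (- sin ?\<phi> / sin \<theta>) * (sin \<theta>)\<^sup>2 + (-1) ^ r * (cos ?\<phi> / cos \<theta>) * (cos \<theta>)\<^sup>2"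
    by (simp only: bad G(2) flip: sum_distrib_left)
  also have "\<dots> = (-1) ^ r * (cos ?\<phi> * cos \<theta> - sin ?\<phi> * sin \<theta>)"
    using nz by (simp add: power2_eq_square right_diff_distrib)
  also have "cos ?\<phi> * cos \<theta> - sin ?\<phi> * sin \<theta> = cos (?\<phi> + \<theta>)"
    by (simp add: cos_add)
  finally have S: "(\<Sum>i\<le>m. \<psi> i * ((if i \<in> G then -1 else 1) * grover G \<psi> r i)) = (-1) ^ r * cos (?\<phi> + \<theta>)" .
  \<comment> \<open>The midpoint of the old angle \<open>p - \<theta>\<close> and the new angle
    \<open>p + \<theta>\<close>, which reduces the recursion to addition formulas.\<close>
  define p where "p = ?\<phi> + \<theta>"
  have next_angle: "(2 * real (Suc r) + 1) * \<theta> = p + \<theta>" and angle: "?\<phi> = p - \<theta>"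
    by (simp_all add: p_def algebra_simps)
  have good: "sin (p + \<theta>) / sin \<theta> = sin (p - \<theta>) / sin \<theta> + 2 * cos p"
    and bad: "cos (p + \<theta>) / cos \<theta> = 2 * cos p - cos (p - \<theta>) / cos \<theta>"
    using nz by (simp_all add: sin_add sin_diff cos_add cos_diff field_simps)
  have step: "grover G \<psi> (Suc r) j = (if j \<in> G then -1 else 1) * grover G \<psi> r j - 2 * \<psi> j * ((-1) ^ r * cos p)"
    using S by (simp add: p_def)
  show ?case
    unfolding step Suc.IH[OF Suc.prems] next_angle angle good bad
    by (simp add: algebra_simps)
qed

end

section \<open>The balanced tree\<close>

text \<open>Each old leaf uses up one pair while the supply lasts. The leftover count is part of the
  claim because the right subtree starts with what the left one returns.\<close>

lemma length_grow:
  "length (leaf_paths (fst (grow d t))) = length (leaf_paths t) + min d (length (leaf_paths t))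
   \<and> snd (grow d t) = d - length (leaf_paths t)"
proof (induction t arbitrary: d)
  case Leaf
  then show ?case by simp
next
  case (Node l r)
  have "grow d (Node l r) = (Node (fst (grow d l)) (fst (grow (snd (grow d l)) r)), snd (grow (snd (grow d l)) r))"
    by (simp add: case_prod_beta Let_def)
  then show ?case using Node.IH(1)[of d] Node.IH(2)[of "snd (grow d l)"] by auto
qed

lemma length_complete_tree: "length (leaf_paths (complete_tree r)) = 2 ^ r"
  by (induction r) auto

lemma tree_depth_exp:
  assumes "0 < m"
  shows "2 ^ tree_depth_exp m \<le> m \<and> m < 2 ^ Suc (tree_depth_exp m)"
  unfolding tree_depth_exp_def
proof (rule theI')
  have "\<exists>r. 2 ^ r \<le> m \<and> m < 2 ^ Suc r"
    using assms
  proof (induction m rule: nat_induct_non_zero)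
    case 1
    then show ?case by (intro exI[of _ 0]) simp
  next
    case (Suc m)
    then obtain r where r: "2 ^ r \<le> m" "m < 2 ^ Suc r" by blast
    then show ?case
      by (cases "Suc m < 2 ^ Suc r") (auto intro: exI[of _ r] exI[of _ "Suc r"])
  qed
  moreover have "r = s" if "2 ^ r \<le> m \<and> m < 2 ^ Suc r" "2 ^ s \<le> m \<and> m < 2 ^ Suc s" for r s
  proof -
    have "(2::nat) ^ r < 2 ^ Suc s" "(2::nat) ^ s < 2 ^ Suc r" using that by linarith+
    then show "r = s" by (metis less_Suc_eq_le one_less_numeral_iff order_antisym power_strict_increasing_iff semiring_norm(76))
  qed
  ultimately show "\<exists>!r. 2 ^ r \<le> m \<and> m < 2 ^ Suc r" by blast
qed

lemma length_the_tree: "0 < m \<Longrightarrow> length (leaf_paths (the_tree m)) = m"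
proof -
  let ?p = "2 ^ tree_depth_exp m :: nat"
  assume "0 < m"
  \<comment> \<open>There are at most as many spare pairs as old leaves, so all are placed and the
    leaves number \<open>?p + (m - ?p)\<close>.\<close>
  then have "?p \<le> m" "m - ?p \<le> ?p" using tree_depth_exp[of m] by auto
  then show ?thesis by (simp add: the_tree_def length_grow length_complete_tree)
qed

definition tree_nodes :: "btree \<Rightarrow> bool list set" where
  "tree_nodes t = {p. \<exists>q. p @ q \<in> set (leaf_paths t)}"

lemma tree_nodes_Leaf: "tree_nodes Leaf = {[]}"
  by (auto simp: tree_nodes_def)

lemma tree_nodes_Node: "tree_nodes (Node l r) \<subseteq> insert [] (Cons False ` tree_nodes l \<union> Cons True ` tree_nodes r)"
proof
  fix p assume "p \<in> tree_nodes (Node l r)"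
  then obtain q where "p @ q \<in> set (leaf_paths (Node l r))" by (auto simp: tree_nodes_def)
  then show "p \<in> insert [] (Cons False ` tree_nodes l \<union> Cons True ` tree_nodes r)"
    by (cases p) (auto simp: tree_nodes_def)
qed

text \<open>A full binary tree with L leaves has 2 L - 1 nodes. Counting nodes rather than path
  lengths saves a factor log m, since leaf paths share their prefixes.\<close>

lemma card_tree_nodes: "finite (tree_nodes t) \<and> Suc (card (tree_nodes t)) \<le> 2 * length (leaf_paths t)"
proof (induction t)
  case Leaf
  then show ?case by (simp add: tree_nodes_Leaf)
next
  case (Node l r)
  let ?S = "insert [] (Cons False ` tree_nodes l \<union> Cons True ` tree_nodes r)"
  have fin: "finite ?S" using Node by simp
  have "card (tree_nodes (Node l r)) \<le> card ?S"
    by (rule card_mono[OF fin tree_nodes_Node])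
  also have "\<dots> \<le> Suc (card (Cons False ` tree_nodes l \<union> Cons True ` tree_nodes r))"
    by (rule card_insert_le_m1) auto
  also have "\<dots> \<le> Suc (card (tree_nodes l) + card (tree_nodes r))"
    using Node by (intro Suc_leI le_imp_less_Suc order_trans[OF card_Un_le] add_mono card_image_le) auto
  finally show ?case using Node finite_subset[OF tree_nodes_Node fin] by simp
qed

lemma tree_nodes_prefix: "p @ q \<in> tree_nodes t \<Longrightarrow> p \<in> tree_nodes t"
  by (auto simp: tree_nodes_def)

lemma tree_path_node:
  assumes "j \<in> {1..m}"
  shows "tree_path m j \<in> tree_nodes (the_tree m)"
proof -
  have "tree_path m j \<in> set (leaf_paths (the_tree m))"
    unfolding tree_path_def using assms by (intro nth_mem) (auto simp: length_the_tree)
  then show ?thesis by (auto simp: tree_nodes_def intro: exI[of _ "[]"])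
qed

section \<open>The cells that certify a positive input\<close>

lemma follow_append:
  "follow x c (p @ q) = (case follow x c p of None \<Rightarrow> None | Some c' \<Rightarrow> follow x c' q)"
  by (induction p arbitrary: c) (auto split: option.split)

text \<open>Which cell of a column is special is unknown while the column is being read, so pointers
  of every row count. In a marked column of a positive input only the special cell can have
  one.\<close>

inductive linked :: "nat \<Rightarrow> (cell \<Rightarrow> sym) \<Rightarrow> nat \<Rightarrow> nat \<Rightarrow> bool" for n y b where
  start: "linked n y b b"
| step: "linked n y b j \<Longrightarrow> i \<in> {1..n} \<Longrightarrow> ipoint (y (i, j)) = Some c \<Longrightarrow> linked n y b (snd c)"

definition needed :: "nat \<Rightarrow> nat \<Rightarrow> nat \<Rightarrow> (cell \<Rightarrow> sym) \<Rightarrow> cell set" where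
  "needed n m b y = {(i, j). i \<in> {1..n} \<and> linked n y b j} \<union>
     {l. \<exists>i\<in>{1..n}. \<exists>p\<in>tree_nodes (the_tree m). follow y (i, b) p = Some l}"

abbreviation blank :: sym where
  "blank \<equiv> (True, None, None, None)"

section \<open>Needed cells under partial knowledge\<close>

definition below :: "(cell \<Rightarrow> sym) \<Rightarrow> (cell \<Rightarrow> sym) \<Rightarrow> bool" where
  "below y x = (\<forall>c. y c = x c \<or> y c = blank)"

lemma blank_pointers [simp]: "lpoint blank = None" "rpoint blank = None" "ipoint blank = None"
  by (simp_all add: lpoint_def rpoint_def ipoint_def)

text \<open>A blank carries no pointer, so a walk in \<open>y\<close> only leaves cells where
  \<open>y\<close> and \<open>x\<close> agree.\<close>

lemma follow_mono:
  assumes "below y x" "follow y c p = Some l"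
  shows "follow x c p = Some l"
  using assms(2)
proof (induction p arbitrary: c)
  case Nil
  then show ?case by simp
next
  case (Cons d p)
  then have "y c \<noteq> blank" by (auto split: if_splits)
  then have "y c = x c" using assms(1) unfolding below_def by blast
  then show ?case using Cons by (auto split: if_splits option.splits)
qed

lemma linked_mono:
  assumes "below y x" "linked n y b j"
  shows "linked n x b j"
  using assms(2)
proof induction
  case start
  then show ?case by (rule linked.start)
next
  case (step j i c)
  then have "y (i, j) \<noteq> blank" by auto
  then have "y (i, j) = x (i, j)" using assms(1) unfolding below_def by blast
  then show ?case using step linked.step by metis
qed

lemma needed_mono: "below y x \<Longrightarrow> needed n m b y \<subseteq> needed n m b x"
  unfolding needed_def by (blast intro: follow_mono linked_mono)

text \<open>Induction along the pointers: the cell from which \<open>x\<close> takes its next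
  pointer was reached in \<open>y\<close> as well, hence is needed there and holds the same symbol.
  So once everything needed by a partial view is known, nothing is missing.\<close>

lemma needed_closed:
  assumes eq: "\<And>c. c \<in> needed n m b y \<Longrightarrow> y c = x c"
  shows "needed n m b x \<subseteq> needed n m b y"
proof -
  have l: "linked n y b j" if "linked n x b j" for j
    using that
  proof induction
    case start
    then show ?case by (rule linked.start)
  next
    case (step j i c)
    then have "y (i, j) = x (i, j)" by (intro eq) (auto simp: needed_def)
    then show ?case using step linked.step by metis
  qed
  have f: "follow y (i, b) p = Some l"
    if "follow x (i, b) p = Some l" "p \<in> tree_nodes (the_tree m)" "i \<in> {1..n}" for i p l
    using that
  proof (induction p arbitrary: l rule: rev_induct)
    case Nil
    then show ?case by simp
  next
    case (snoc d p)
    obtain c where c: "follow x (i, b) p = Some c"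
      using snoc.prems(1) by (auto simp: follow_append split: option.splits)
    have p: "p \<in> tree_nodes (the_tree m)" using snoc.prems(2) by (rule tree_nodes_prefix)
    have yc: "follow y (i, b) p = Some c" using snoc.IH[OF c p snoc.prems(3)] .
    then have "y c = x c" using p snoc.prems(3) by (intro eq) (auto simp: needed_def)
    then show ?case using snoc.prems(1) c yc by (cases d) (auto simp: follow_append split: option.splits)
  qed
  show ?thesis unfolding needed_def using l f by blast
qed

lemma follow_cells:
  assumes "valid_input n m x" "c \<in> cells n m" "follow x c p = Some l"
  shows "l \<in> cells n m"
  using assms(2,3)
proof (induction p arbitrary: c)
  case Nil
  then show ?case by simp
next
  case (Cons d p)
  then obtain c' where c': "(if d then rpoint (x c) else lpoint (x c)) = Some c'" "follow x c' p = Some l"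
    by (auto split: option.splits)
  moreover have "c' \<in> cells n m"
    using assms(1) Cons.prems(1) c'(1) by (force simp: valid_input_def valid_ptr_def split: if_splits)
  ultimately show ?case using Cons.IH by blast
qed

lemma needed_cells:
  assumes "valid_input n m x" "b \<in> {1..m}"
  shows "needed n m b x \<subseteq> cells n m"
proof -
  have "j \<in> {1..m}" if "linked n x b j" for j
    using that
  proof induction
    case start
    then show ?case using assms(2) .
  next
    case (step j i c)
    then have "(i, j) \<in> cells n m" by (simp add: cells_def)
    then have "c \<in> cells n m" using assms(1) step(3) by (force simp: valid_input_def valid_ptr_def)
    then show ?case by (auto simp: cells_def)
  qed
  moreover have "l \<in> cells n m" if "follow x (i, b) p = Some l" "i \<in> {1..n}" for i p l
    using follow_cells[OF assms(1) _ that(1)] that(2) assms(2) by (auto simp: cells_def)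
  ultimately show ?thesis by (auto simp: needed_def cells_def)
qed

section \<open>Positive inputs: size and sufficiency of the certificate\<close>

lemma finite_marked_cols: "finite (marked_cols n m x)"
  by (simp add: marked_cols_def)

lemma is_special_iff:
  "is_special n m x (i, b) \<longleftrightarrow> i \<in> {1..n} \<and> b \<in> marked_cols n m x \<and> x (i, b) \<noteq> blank"
  by (auto simp: is_special_def cells_def marked_cols_def)

lemma h_funE:
  assumes "h_fun k n m x"
  obtains a where "card (marked_cols n m x) = k"
    and "\<And>b. b \<in> marked_cols n m x \<Longrightarrow> \<exists>!i. i \<in> {1..n} \<and> x (i, b) \<noteq> blank"
    and "\<And>s. s \<in> {1..k} \<Longrightarrow> is_special n m x (a s)"
    and "bij_betw (\<lambda>s. snd (a s)) {1..k} (marked_cols n m x)"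
    and "\<And>s. s \<in> {1..<k} \<Longrightarrow> ipoint (x (a s)) = Some (a (Suc s))"
    and "ipoint (x (a k)) = Some (a 1)"
    and "\<And>s t. s \<in> {1..k} \<Longrightarrow> t \<in> {1..k} \<Longrightarrow> lpoint (x (a s)) = lpoint (x (a t)) \<and> rpoint (x (a s)) = rpoint (x (a t))"
proof -
  note h = assms[unfolded h_fun_def]
  from h obtain a where a: "(\<forall>s\<in>{1..k}. is_special n m x (a s)) \<and>
      bij_betw (\<lambda>s. snd (a s)) {1..k} (marked_cols n m x) \<and>
      (\<forall>s\<in>{1..<k}. ipoint (x (a s)) = Some (a (Suc s))) \<and>
      ipoint (x (a k)) = Some (a 1) \<and>
      (\<forall>s\<in>{1..k}. \<forall>t\<in>{1..k}. lpoint (x (a s)) = lpoint (x (a t)) \<and> rpoint (x (a s)) = rpoint (x (a t)))"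
    by (elim conjE exE) simp
  show thesis
    by (rule that[of a, OF h[THEN conjunct1] h[THEN conjunct2, THEN conjunct1, rule_format]]) (use a in blast)+
qed

lemma h_fun_card: "h_fun k n m x \<Longrightarrow> card (marked_cols n m x) = k"
  unfolding h_fun_def by (elim conjE)

lemma h_fun_unique:
  "h_fun k n m x \<Longrightarrow> b \<in> marked_cols n m x \<Longrightarrow> \<exists>!i. i \<in> {1..n} \<and> x (i, b) \<noteq> blank"
  by (erule h_funE) simp

lemma h_fun_path:
  assumes "h_fun k n m x" "j \<in> {1..m} - marked_cols n m x" "is_special n m x a"
  obtains l where "follow x a (tree_path m j) = Some l" "snd l = j" "\<not> val (x l)"
  using assms(1)[unfolded h_fun_def, THEN conjunct2, THEN conjunct2, THEN conjunct2] assms(2,3) by blast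

text \<open>A non-blank cell of a marked column is its unique special element, so links run along
  the cycle of special elements and never leave it.\<close>

lemma linked_iff_marked:
  assumes h: "h_fun k n m x" and b: "b \<in> marked_cols n m x"
  shows "linked n x b j \<longleftrightarrow> j \<in> marked_cols n m x"
proof -
  let ?M = "marked_cols n m x"
  obtain a where sp: "\<And>s. s \<in> {1..k} \<Longrightarrow> is_special n m x (a s)"
    and bij: "bij_betw (\<lambda>s. snd (a s)) {1..k} ?M"
    and nxt: "\<And>s. s \<in> {1..<k} \<Longrightarrow> ipoint (x (a s)) = Some (a (Suc s))"
    and cyc: "ipoint (x (a k)) = Some (a 1)"
    and uniq: "\<And>b. b \<in> ?M \<Longrightarrow> \<exists>!i. i \<in> {1..n} \<and> x (i, b) \<noteq> blank"
    by (rule h_funE[OF h]) blast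
  have img: "(\<lambda>s. snd (a s)) ` {1..k} = ?M" using bij by (simp add: bij_betw_def)
  have row: "fst (a s) \<in> {1..n}" if "s \<in> {1..k}" for s
    using sp[OF that] by (auto simp: is_special_def cells_def)
  have "j \<in> ?M" if "linked n x b j"
    using that
  proof induction
    case start
    then show ?case using b .
  next
    case (step j i c)
    obtain s where s: "s \<in> {1..k}" "j = snd (a s)" using step.IH unfolding img[symmetric] by blast
    have "x (i, j) \<noteq> blank" using step.hyps(3) by auto
    moreover have "x (fst (a s), j) \<noteq> blank" using sp[OF s(1)] s(2) by (simp add: is_special_def)
    ultimately have "i = fst (a s)" using uniq[OF step.IH] step.hyps(2) row[OF s(1)] by blast
    then have i: "ipoint (x (a s)) = Some c" using step.hyps(3) s(2) by simp
    have "c \<in> a ` {1..k}"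
    proof (cases "s = k")
      case True
      then show ?thesis using i cyc s(1) by auto
    next
      case False
      then show ?thesis using i nxt[of s] s(1) by auto
    qed
    then show ?case using img by auto
  qed
  moreover have "linked n x b j" if j: "j \<in> ?M"
  proof -
    have follow_next: "linked n x b (snd (a t))"
      if "s \<in> {1..k}" "linked n x b (snd (a s))" "ipoint (x (a s)) = Some (a t)" for s t
      using linked.step[of n x b "snd (a s)" "fst (a s)" "a t"] that row by simp
    have up: "linked n x b (snd (a (s + d)))"
      if "s \<in> {1..k}" "linked n x b (snd (a s))" "s + d \<le> k" for s d
      using that
    proof (induction d)
      case (Suc d)
      then show ?case using follow_next[of "s + d" "Suc (s + d)"] nxt[of "s + d"] by auto
    qed simp
    obtain s where s: "s \<in> {1..k}" "b = snd (a s)" using b unfolding img[symmetric] by blast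
    \<comment> \<open>The cycle is entered at an arbitrary index: up to the last element, across to
      the first, then up to the target.\<close>
    have "linked n x b (snd (a k))" using up[of s "k - s"] s linked.start[of n x b] by auto
    then have "linked n x b (snd (a 1))" using follow_next[of k 1] cyc s(1) by auto
    moreover obtain t where "t \<in> {1..k}" "j = snd (a t)" using j unfolding img[symmetric] by blast
    ultimately show ?thesis using up[of 1 "t - 1"] by auto
  qed
  ultimately show ?thesis by blast
qed

text \<open>\<open>k * n\<close> counts the marked columns. In column \<open>b\<close> only the
  special cell can start a nonempty walk, so the walks add at most one cell per tree node; an empty
  walk ends in the column itself.\<close>

lemma card_needed:
  assumes h: "h_fun k n m x" and b: "b \<in> marked_cols n m x" and m: "0 < m"
  shows "card (needed n m b x) \<le> k * n + 2 * m"
proof -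
  let ?M = "marked_cols n m x"
  have M: "card ?M = k" and uniq: "\<exists>!i. i \<in> {1..n} \<and> x (i, b) \<noteq> blank"
    using h_fun_card[OF h] h_fun_unique[OF h b] by simp_all
  obtain r where r: "\<And>i. i \<in> {1..n} \<Longrightarrow> x (i, b) \<noteq> blank \<Longrightarrow> i = r" using uniq by blast
  let ?N = "tree_nodes (the_tree m)"
  have fin: "finite ?N" and cN: "card ?N \<le> 2 * m"
    using card_tree_nodes[of "the_tree m"] length_the_tree[OF m] by auto
  let ?T = "(\<lambda>p. the (follow x (r, b) p)) ` ?N"
  have "needed n m b x \<subseteq> {1..n} \<times> ?M \<union> ?T"
  proof -
    have "l \<in> {1..n} \<times> ?M \<union> ?T" if i: "i \<in> {1..n}" and p: "p \<in> ?N" and l: "follow x (i, b) p = Some l" for i p l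
    proof (cases "x (i, b) = blank")
      case True
      then have "p = []" using l by (cases p) (auto split: if_splits)
      then show ?thesis using l i b by auto
    next
      case False
      then have "l = the (follow x (r, b) p)" using r[OF i] l by simp
      then show ?thesis using p by blast
    qed
    moreover have "{(i, j). i \<in> {1..n} \<and> linked n x b j} = {1..n} \<times> ?M"
      by (auto simp: linked_iff_marked[OF h b])
    ultimately show ?thesis unfolding needed_def by blast
  qed
  then have "card (needed n m b x) \<le> card ({1..n} \<times> ?M \<union> ?T)"
    using fin finite_marked_cols[of n m x] by (intro card_mono) auto
  also have "\<dots> \<le> card ({1..n} \<times> ?M) + card ?T" by (rule card_Un_le)
  also have "\<dots> \<le> k * n + 2 * m"
    using M card_image_le[OF fin, of "\<lambda>p. the (follow x (r, b) p)"] cN by (simp add: card_cartesian_product mult.commute)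
  finally show ?thesis .
qed

lemma follow_cong:
  assumes "follow x c p = Some l"
    and "\<And>q r c'. p = q @ r \<Longrightarrow> r \<noteq> [] \<Longrightarrow> follow x c q = Some c' \<Longrightarrow> x' c' = x c'"
  shows "follow x' c p = Some l"
  using assms
proof (induction p arbitrary: c)
  case Nil
  then show ?case by simp
next
  case (Cons d p)
  have c: "x' c = x c" using Cons.prems(2)[of "[]" "d # p" c] by simp
  obtain c' where c': "(if d then rpoint (x c) else lpoint (x c)) = Some c'" "follow x c' p = Some l"
    using Cons.prems(1) by (auto split: option.splits)
  have "follow x' c' p = Some l"
  proof (rule Cons.IH[OF c'(2)])
    fix q r c'' assume "p = q @ r" "r \<noteq> []" "follow x c' q = Some c''"
    then show "x' c'' = x c''" using Cons.prems(2)[of "d # q" r c''] c'(1) by simp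
  qed
  then show ?case using c c'(1) by (cases d) simp_all
qed

text \<open>\<open>D\<close> contains the marked columns of \<open>x\<close> entirely and, for every
  other column, a 0 at the end of its tree path. So \<open>x'\<close> has the same marked columns,
  special elements and paths.\<close>

lemma h_fun_certificate:
  assumes h: "h_fun k n m x" and b: "b \<in> marked_cols n m x"
    and D: "needed n m b x \<subseteq> D" "D \<subseteq> cells n m" and eq: "\<And>c. c \<in> D \<Longrightarrow> x' c = x c"
  shows "h_fun k n m x'"
proof -
  let ?M = "marked_cols n m x"
  have col: "x' (i, j) = x (i, j)" if "i \<in> {1..n}" "j \<in> ?M" for i j
    using that linked_iff_marked[OF h b] D(1) by (intro eq) (auto simp: needed_def)
  obtain r where r: "r \<in> {1..n}" "x (r, b) \<noteq> blank"
    using h_fun_unique[OF h b] by blast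
  have spr: "is_special n m x (r, b)" using r b by (simp add: is_special_iff)
  have path: "\<exists>l. follow x (r, b) (tree_path m j) = Some l \<and> follow x' (r, b) (tree_path m j) = Some l
      \<and> snd l = j \<and> \<not> val (x l) \<and> x' l = x l \<and> l \<in> cells n m"
    if j: "j \<in> {1..m} - ?M" for j
  proof -
    obtain l where l: "follow x (r, b) (tree_path m j) = Some l" "snd l = j" "\<not> val (x l)"
      by (rule h_fun_path[OF h j spr])
    have nodes: "tree_path m j \<in> tree_nodes (the_tree m)" using j by (intro tree_path_node) auto
    have inD: "c \<in> D" if "follow x (r, b) q = Some c" "q \<in> tree_nodes (the_tree m)" for q c
    proof -
      have "c \<in> needed n m b x" unfolding needed_def using that r(1) by blast
      then show ?thesis using D(1) by blast
    qed
    have "follow x' (r, b) (tree_path m j) = Some l"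
      by (rule follow_cong[OF l(1)]) (metis eq inD nodes tree_nodes_prefix)
    then show ?thesis using l inD[OF l(1) nodes] eq D(2) by blast
  qed
  have M: "marked_cols n m x' = ?M"
  proof
    show "?M \<subseteq> marked_cols n m x'" using col by (auto simp: marked_cols_def)
    show "marked_cols n m x' \<subseteq> ?M"
    proof
      fix j assume j: "j \<in> marked_cols n m x'"
      show "j \<in> ?M"
      proof (rule ccontr)
        assume "j \<notin> ?M"
        then have "j \<in> {1..m} - ?M" using j by (simp add: marked_cols_def)
        then obtain l where l: "snd l = j" "\<not> val (x' l)" "l \<in> cells n m"
          using path by metis
        then show False using j by (cases l) (auto simp: marked_cols_def cells_def)
      qed
    qed
  qed
  have sp: "is_special n m x' a \<longleftrightarrow> is_special n m x a" and spx: "is_special n m x a \<Longrightarrow> x' a = x a" for a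
    using col by (cases a; auto simp: is_special_iff M)+
  have 2: "\<forall>b\<in>?M. \<exists>!i. i \<in> {1..n} \<and> x' (i, b) \<noteq> blank"
  proof
    fix b assume b: "b \<in> ?M"
    have "(i \<in> {1..n} \<and> x' (i, b) \<noteq> blank) \<longleftrightarrow> (i \<in> {1..n} \<and> x (i, b) \<noteq> blank)" for i
      using col b by auto
    then show "\<exists>!i. i \<in> {1..n} \<and> x' (i, b) \<noteq> blank" using h_fun_unique[OF h b] by simp
  qed
  obtain a where "card ?M = k"
    and uniq: "\<And>b. b \<in> ?M \<Longrightarrow> \<exists>!i. i \<in> {1..n} \<and> x (i, b) \<noteq> blank"
    and a: "\<And>s. s \<in> {1..k} \<Longrightarrow> is_special n m x (a s)"
      "bij_betw (\<lambda>s. snd (a s)) {1..k} ?M"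
      "\<And>s. s \<in> {1..<k} \<Longrightarrow> ipoint (x (a s)) = Some (a (Suc s))" "ipoint (x (a k)) = Some (a 1)"
      "\<And>s t. s \<in> {1..k} \<Longrightarrow> t \<in> {1..k} \<Longrightarrow> lpoint (x (a s)) = lpoint (x (a t)) \<and> rpoint (x (a s)) = rpoint (x (a t))"
    by (rule h_funE[OF h]) blast
  have k: "k \<in> {1..k}" using b a(2) by (cases k) (auto simp: bij_betw_def)
  have xa: "x' (a s) = x (a s)" if "s \<in> {1..k}" for s using spx a(1) that by blast
  have img: "(\<lambda>s. snd (a s)) ` {1..k} = ?M" using a(2) by (simp add: bij_betw_def)
  have onto: "c \<in> a ` {1..k}" if c: "is_special n m x c" for c
  proof -
    obtain s where s: "s \<in> {1..k}" "snd c = snd (a s)"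
      using c unfolding is_special_def img[symmetric] by blast
    have "fst c = fst (a s)"
      using c a(1)[OF s(1)] uniq[of "snd c"] s(2)
      by (metis is_special_iff prod.collapse)
    then show ?thesis using s by (metis imageI prod_eqI)
  qed
  have same: "lpoint (x c) = lpoint (x d) \<and> rpoint (x c) = rpoint (x d)"
    if "is_special n m x c" "is_special n m x d" for c d
    using onto[OF that(1)] onto[OF that(2)] a(5) by blast
  have 4: "\<exists>l. follow x' c (tree_path m j) = Some l \<and> snd l = j \<and> \<not> val (x' l)"
    if j: "j \<in> {1..m} - ?M" and c: "is_special n m x c" for j c
  proof -
    obtain l where l: "follow x (r, b) (tree_path m j) = Some l" "follow x' (r, b) (tree_path m j) = Some l"
      "snd l = j" "\<not> val (x' l)" using path[OF j] by auto
    \<comment> \<open>A path from the marked column \<open>b\<close> to the unmarked column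
      \<open>j\<close> has a first step, and by \<open>same\<close> this step leads from every
      special element to the same cell.\<close>
    have "tree_path m j \<noteq> []" using l(1,3) j b by auto
    then obtain d p where "tree_path m j = d # p" by (cases "tree_path m j") auto
    then have "follow x' c (tree_path m j) = follow x' (r, b) (tree_path m j)"
      using same[OF c spr] spx[OF c] spx[OF spr] by simp
    then show ?thesis using l by auto
  qed
  have "\<exists>a. (\<forall>s\<in>{1..k}. is_special n m x' (a s)) \<and> bij_betw (\<lambda>s. snd (a s)) {1..k} ?M \<and>
          (\<forall>s\<in>{1..<k}. ipoint (x' (a s)) = Some (a (Suc s))) \<and> ipoint (x' (a k)) = Some (a 1) \<and>
          (\<forall>s\<in>{1..k}. \<forall>t\<in>{1..k}. lpoint (x' (a s)) = lpoint (x' (a t)) \<and> rpoint (x' (a s)) = rpoint (x' (a t)))"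
  proof (intro exI[of _ a] conjI ballI)
    show "is_special n m x' (a s)" if "s \<in> {1..k}" for s using a(1)[OF that] sp by simp
    show "bij_betw (\<lambda>s. snd (a s)) {1..k} ?M" by (rule a(2))
    show "ipoint (x' (a s)) = Some (a (Suc s))" if "s \<in> {1..<k}" for s using a(3)[OF that] xa[of s] that by simp
    show "ipoint (x' (a k)) = Some (a 1)" using a(4) xa[OF k] by simp
    show "lpoint (x' (a s)) = lpoint (x' (a t))" "rpoint (x' (a s)) = rpoint (x' (a t))"
      if "s \<in> {1..k}" "t \<in> {1..k}" for s t using a(5)[OF that] xa that by simp_all
  qed
  then show ?thesis unfolding h_fun_def M using \<open>card ?M = k\<close> 2 4 sp by simp
qed

section \<open>The search algorithm\<close>

text \<open>
  Unknown cells are read as \<open>blank\<close>, which carries no pointer: this makes the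
  needed set monotone in what is known, so the search never leaves the set needed in the end.
\<close>

definition reveal :: "(cell \<rightharpoonup> sym) \<Rightarrow> cell \<Rightarrow> sym" where
  "reveal K = (\<lambda>c. case K c of Some s \<Rightarrow> s | None \<Rightarrow> blank)"

text \<open>For a column \<open>b\<close> the first \<open>n\<close> queries are fixed, which makes
  them the column test. The query to \<open>(1, 1)\<close> is a filler: all branches must make the
  same number of queries. The dummy index 0 skips the scan.\<close>

definition strategy :: "nat \<Rightarrow> nat \<Rightarrow> nat \<Rightarrow> nat \<Rightarrow> (cell \<rightharpoonup> sym) \<Rightarrow> cell" where
  "strategy n m b t K =
    (if b \<in> {1..m} \<and> t < n then (Suc t, b)
     else if cells n m \<inter> needed n m b (reveal K) - dom K = {} then (1, 1)
     else (SOME c. c \<in> cells n m \<inter> needed n m b (reveal K) - dom K))"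

lemma strategy_new:
  assumes "\<not> (b \<in> {1..m} \<and> t < n)" "cells n m \<inter> needed n m b (reveal K) - dom K \<noteq> {}"
  shows "strategy n m b t K \<in> cells n m \<inter> needed n m b (reveal K) - dom K"
proof -
  have "strategy n m b t K = (SOME c. c \<in> cells n m \<inter> needed n m b (reveal K) - dom K)"
    using assms by (simp only: strategy_def if_False)
  moreover have "(SOME c. c \<in> cells n m \<inter> needed n m b (reveal K) - dom K) \<in> cells n m \<inter> needed n m b (reveal K) - dom K"
    using assms(2) by (simp only: some_in_eq not_False_eq_True)
  ultimately show ?thesis by simp
qed

text \<open>\<open>butlast\<close> drops the start index; the range condition excludes the dummy
  0.\<close>

definition column_marked :: "nat \<Rightarrow> nat list \<Rightarrow> bool" where
  "column_marked m H \<longleftrightarrow> last H \<in> {1..m} \<and> (\<forall>v\<in>set (butlast H). odd v)"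

locale grid =
  fixes n m :: nat
  assumes n_pos: "0 < n" and m_pos: "0 < m"

sublocale grid \<subseteq> query_strategy n m "strategy n m"
proof
  fix b t K
  show "strategy n m b t K \<in> cells n m"
  proof (cases "b \<in> {1..m} \<and> t < n \<or> cells n m \<inter> needed n m b (reveal K) - dom K = {}")
    case True
    then show ?thesis using n_pos m_pos by (auto simp: strategy_def cells_def)
  next
    case False
    then show ?thesis using strategy_new[of b m t n K] by blast
  qed
qed

section \<open>Progress of the search and its query count\<close>

context grid
begin

lemma next_cell_hist: "next_cell (hist x t b) = strategy n m b t (known (hist x t b))"
  by (simp add: next_cell_def)

lemma known_correct:
  assumes "valid_input n m x" "known (hist x t b) c = Some s"
  shows "s = x c"
  using assms(2)
proof (induction t)
  case 0
  then show ?case by simp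
next
  case (Suc t)
  then show ?case by (auto simp: known_hist_Suc decode_answer[OF assms(1)] simp del: hist.simps split: if_splits)
qed

lemma dom_known_Suc: "dom (known (hist x (Suc t) b)) = insert (next_cell (hist x t b)) (dom (known (hist x t b)))"
  by (simp only: known_hist_Suc dom_fun_upd) simp

lemma dom_known_cells: "dom (known (hist x t b)) \<subseteq> cells n m"
proof (induction t)
  case (Suc t)
  then show ?case unfolding dom_known_Suc using next_cell_cells by simp
qed simp

lemma same_history:
  assumes "valid_input n m x" "valid_input n m x'" "hist x' t b = hist x t b" "c \<in> dom (known (hist x t b))"
  shows "x' c = x c"
proof -
  obtain s where s: "known (hist x t b) c = Some s" using assms(4) by blast
  then show ?thesis
    using known_correct[OF assms(1) s] known_correct[OF assms(2), of t b c s] assms(3) by simp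
qed

lemma below_reveal: "valid_input n m x \<Longrightarrow> below (reveal (known (hist x t b))) x"
  unfolding below_def reveal_def by (metis known_correct option.case_eq_if option.collapse)

lemma column_marked_iff:
  assumes "b \<in> {1..m}"
  shows "column_marked m (hist x n b) \<longleftrightarrow> b \<in> marked_cols n m x"
proof -
  have "set (butlast (hist x t b)) = (\<lambda>i. sym_code n m (x (i, b))) ` {1..t}" if "t \<le> n" for t
    using that
  proof (induction t)
    case (Suc t)
    then have "next_cell (hist x t b) = (Suc t, b)" using assms by (simp add: next_cell_hist strategy_def)
    then show ?case using Suc by (simp add: answer_def atLeastAtMostSuc_conv)
  qed simp
  from this[of n] show ?thesis
    using assms by (auto simp: column_marked_def marked_cols_def odd_sym_code)
qed

text \<open>After the scan, each query made while a needed cell is still unknown hits a new needed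
  cell: it is needed by the partial view, and by monotonicity by \<open>x\<close> itself.\<close>

lemma needed_queried:
  assumes v: "valid_input n m x" and b: "b \<in> {1..m}" and card: "card (needed n m b x) \<le> N"
  shows "needed n m b x \<subseteq> dom (known (hist x (n + N) b))"
proof -
  let ?R = "needed n m b x" and ?K = "\<lambda>t. known (hist x (n + t) b)"
  have R: "?R \<subseteq> cells n m" by (rule needed_cells[OF v b])
  have fin: "finite ?R" using R by (rule finite_subset) (simp add: cells_def)
  have "?R \<subseteq> dom (?K t) \<or> t \<le> card (?R \<inter> dom (?K t))" for t
  proof (induction t)
    case (Suc t)
    have dom: "dom (?K (Suc t)) = insert (next_cell (hist x (n + t) b)) (dom (?K t))"
      using dom_known_Suc[of x "n + t" b] by simp
    have mono: "needed n m b (reveal (?K t)) \<subseteq> ?R"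
      by (rule needed_mono[OF below_reveal[OF v]])
    show ?case
    proof (cases "?R \<subseteq> dom (?K t)")
      case True
      then show ?thesis unfolding dom by blast
    next
      case False
      \<comment> \<open>Otherwise the partial view would be closed, and by
        \<open>needed_closed\<close> every cell of \<open>?R\<close> would already be known.\<close>
      have "\<not> needed n m b (reveal (?K t)) \<subseteq> dom (?K t)"
      proof
        assume closed: "needed n m b (reveal (?K t)) \<subseteq> dom (?K t)"
        have "?R \<subseteq> needed n m b (reveal (?K t))"
          by (rule needed_closed)
             (use closed known_correct[OF v, of "n + t" b] in \<open>auto simp: reveal_def dom_def split: option.splits\<close>)
        with closed False show False by blast
      qed
      then have "cells n m \<inter> needed n m b (reveal (?K t)) - dom (?K t) \<noteq> {}"
        using mono R by blast
      from strategy_new[OF _ this, of "n + t"]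
      have new: "next_cell (hist x (n + t) b) \<in> ?R - dom (?K t)"
        using mono by (auto simp: next_cell_hist)
      then have split: "?R \<inter> dom (?K (Suc t)) = insert (next_cell (hist x (n + t) b)) (?R \<inter> dom (?K t))"
        unfolding dom by blast
      have "card (?R \<inter> dom (?K (Suc t))) = Suc (card (?R \<inter> dom (?K t)))"
        unfolding split using new fin by (intro card_insert_disjoint) auto
      then show ?thesis using Suc False by linarith
    qed
  qed simp
  from this[of N] show ?thesis
  proof
    assume "N \<le> card (?R \<inter> dom (?K N))"
    then have "?R \<inter> dom (?K N) = ?R"
      using card fin by (intro card_seteq) auto
    then show ?thesis by blast
  qed
qed

text \<open>Each of the \<open>r\<close> rounds tests and untests a column with \<open>2 * n\<close>
  queries; a last run repeats the scan, collects the certificate and is not undone.\<close>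

lemma exact_alg_h_fun:
  assumes k: "1 \<le> k" and \<theta>: "(2 * real r + 1) * \<theta> = pi / 2" "1 \<le> r" "(sin \<theta>)\<^sup>2 \<le> real k / real m"
  shows "exact_alg n m (h_fun k n m) (r * (2 * n) + (n + (k * n + 2 * m)))"
proof -
  \<comment> \<open>The common amplitude for which \<open>k\<close> columns together have weight
    \<open>(sin \<theta>)\<^sup>2\<close>.\<close>
  define q where "q = sin \<theta> / sqrt (real k)"
  \<comment> \<open>Index 0 is a dummy that is never marked; its weight makes the angle of the marked part exactly \<open>\<theta>\<close>.\<close>
  define \<psi> where "\<psi> = (\<lambda>j::nat. if j = 0 then sqrt (1 - real m * q\<^sup>2) else q)"
  have qq: "real k * q\<^sup>2 = (sin \<theta>)\<^sup>2" using k by (simp add: q_def power_divide)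
  \<comment> \<open>Here the bound on \<open>sin \<theta>\<close> enters: the true columns weigh at
    most 1 in total, which leaves a nonnegative weight for the dummy.\<close>
  have "real m * q\<^sup>2 = (sin \<theta>)\<^sup>2 * (real m / real k)" using k by (simp add: q_def power_divide)
  also have "\<dots> \<le> (real k / real m) * (real m / real k)" using \<theta>(3) by (intro mult_right_mono) auto
  also have "\<dots> = 1" using k m_pos by simp
  finally have q1: "real m * q\<^sup>2 \<le> 1" .
  have "(\<Sum>j\<le>m. \<psi> j * \<psi> j) = \<psi> 0 * \<psi> 0 + (\<Sum>j\<in>{1..m}. \<psi> j * \<psi> j)"
    by (simp add: sum.atMost_shift sum.atLeast1_atMost_eq lessThan_Suc_atMost)
  also have "(\<Sum>j\<in>{1..m}. \<psi> j * \<psi> j) = (\<Sum>j\<in>{1..m}. q\<^sup>2)"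
    by (rule sum.cong) (auto simp: \<psi>_def power2_eq_square)
  also have "\<psi> 0 * \<psi> 0 + \<dots> = 1" using q1 by (simp add: \<psi>_def)
  finally have unit: "(\<Sum>j\<le>m. \<psi> j * \<psi> j) = 1" .
  have \<theta>_eq: "\<theta> = pi / (2 * (2 * real r + 1))" using \<theta>(1) by (simp add: field_simps)
  have "0 < \<theta>" unfolding \<theta>_eq using pi_gt_zero by (intro divide_pos_pos) auto
  \<comment> \<open>\<open>1 \<le> r\<close> keeps \<theta> strictly below pi / 2, so that
    \<open>cos \<theta>\<close> is nonzero in the closed form.\<close>
  moreover have "\<theta> < pi / 2" unfolding \<theta>_eq using pi_gt_zero \<theta>(2) by (intro divide_strict_left_mono) auto
  ultimately have nz: "sin \<theta> \<noteq> 0" "cos \<theta> \<noteq> 0"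
    using sin_gt_zero_02 cos_gt_zero[of \<theta>] sin_gt_zero[of \<theta>] by auto
  show ?thesis
  proof (rule exact_alg_grover[OF _ unit, where good = "column_marked m"])
    show "n \<le> n + (k * n + 2 * m)" by simp
    fix x x' j
    let ?G = "{j. column_marked m (hist x n j)}" and ?L = "n + (k * n + 2 * m)"
    assume v: "valid_input n m x" and h: "h_fun k n m x" and j: "j \<le> m"
      and amp: "grover ?G \<psi> r j \<noteq> 0"
      and v': "valid_input n m x'" and same: "hist x' ?L j = hist x ?L j"
    have "?G \<subseteq> {1..m}"
    proof
      show "i \<in> {1..m}" if "i \<in> ?G" for i using that by (simp add: column_marked_def)
    qed
    then have G: "?G = marked_cols n m x"
      using column_marked_iff[of _ x] by (auto simp: marked_cols_def)
    have "(\<Sum>j\<in>?G. \<psi> j * \<psi> j) = (\<Sum>j\<in>marked_cols n m x. q\<^sup>2)"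
      unfolding G by (rule sum.cong) (auto simp: \<psi>_def marked_cols_def power2_eq_square)
    also have "\<dots> = (sin \<theta>)\<^sup>2" using qq h_fun_card[OF h] by simp
    finally have GS: "(\<Sum>j\<in>?G. \<psi> j * \<psi> j) = (sin \<theta>)\<^sup>2" .
    have "?G \<subseteq> {..m}" using \<open>?G \<subseteq> {1..m}\<close> by auto
    \<comment> \<open>At the angle pi / 2 the cosine vanishes, and with it the amplitude of every
      unmarked index, the dummy included.\<close>
    then have "j \<in> ?G"
      using amp grover_closed_form[OF _ GS unit nz j, of r] unfolding \<theta>(1) by (auto split: if_splits)
    then have marked: "j \<in> marked_cols n m x" and j1: "j \<in> {1..m}"
      using G by (auto simp: marked_cols_def)
    have sub: "needed n m j x \<subseteq> dom (known (hist x ?L j))"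
      by (rule needed_queried[OF v j1 card_needed[OF h marked m_pos]])
    show "h_fun k n m x'"
      by (rule h_fun_certificate[OF h marked sub dom_known_cells same_history[OF v v' same]])
  qed
qed

end

section \<open>Choice of the angle and the final bound\<close>

theorem theorem20:
  shows "\<exists>C::real > 0. \<forall>n m k :: nat. 0 < n \<longrightarrow> 0 < m \<longrightarrow> 1 \<le> k \<longrightarrow> k < m \<longrightarrow>
     real (QE n m (h_fun k n m)) \<le> C * (real n * sqrt (real m / real k) + real k * real n + real m)"
proof (intro exI[of _ "4::real"] conjI allI impI)
  fix n m k :: nat
  assume n: "0 < n" and m: "0 < m" and k: "1 \<le> k" "k < m"
  interpret grid n m using n m by unfold_locales
  define s where "s = sqrt (real m / real k)"
  define r where "r = nat \<lceil>s\<rceil>"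
  define \<theta> where "\<theta> = pi / (2 * (2 * real r + 1))"
  have s1: "1 < s" using k by (simp add: s_def)
  have r: "s \<le> real r" "real r \<le> s + 1" using s1 by (simp_all add: r_def)
  have r1: "1 \<le> r" using r(1) s1 by linarith
  have "\<theta> \<le> 1 / s"
  proof -
    \<comment> \<open>The estimate pi < 4 is enough: rounding \<open>s\<close> up to
      \<open>r\<close> makes \<theta> at most \<open>1 / s\<close>, and
      \<open>sin \<theta> \<le> \<theta>\<close> then gives the required weight bound.\<close>
    have "pi * s \<le> 4 * s" using pi_less_4 s1 by (intro mult_right_mono) auto
    also have "\<dots> \<le> 4 * real r" using r(1) by simp
    also have "\<dots> \<le> 2 * (2 * real r + 1)" by simp
    finally show ?thesis using s1 r1 by (simp add: \<theta>_def field_simps)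
  qed
  moreover have \<theta>0: "0 \<le> \<theta>" by (simp add: \<theta>_def)
  moreover have "\<theta> \<le> pi" unfolding \<theta>_def using pi_gt_zero by (simp add: field_simps)
  ultimately have "0 \<le> sin \<theta>" "sin \<theta> \<le> 1 / s"
    using sin_ge_zero[of \<theta>] sin_x_le_x[OF \<theta>0] by auto
  then have "(sin \<theta>)\<^sup>2 \<le> (1 / s)\<^sup>2" by (intro power_mono) auto
  also have "\<dots> = real k / real m" by (simp add: s_def power_divide)
  finally have sin_le: "(sin \<theta>)\<^sup>2 \<le> real k / real m" .
  have "(2 * real r + 1) * \<theta> = pi / 2" by (simp add: \<theta>_def field_simps)
  from exact_alg_h_fun[OF k(1) this r1 sin_le]
  have "QE n m (h_fun k n m) \<le> r * (2 * n) + (n + (k * n + 2 * m))"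
    unfolding QE_def by (rule Least_le)
  then have "real (QE n m (h_fun k n m)) \<le> real (r * (2 * n) + (n + (k * n + 2 * m)))"
    by (rule of_nat_mono)
  also have "\<dots> = 2 * real n * real r + real n + real k * real n + 2 * real m"
    by (simp add: algebra_simps)
  \<comment> \<open>Since \<open>1 < s\<close>, \<open>r \<le> s + 1 \<le> 2 * s\<close>, and
    \<open>1 \<le> k\<close> absorbs the single \<open>n\<close> into \<open>k * n\<close>. The term
    \<open>4 * n * s\<close> dictates the constant 4.\<close>
  also have "\<dots> \<le> 2 * real n * (2 * s) + real k * real n + real k * real n + 2 * real m"
    using r(2) s1 k n by (intro add_mono mult_left_mono) auto
  also have "\<dots> \<le> 4 * (real n * s + real k * real n + real m)"
    by simp
  finally show "real (QE n m (h_fun k n m)) \<le> 4 * (real n * sqrt (real m / real k) + real k * real n + real m)"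
    unfolding s_def .
qed simp

end
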